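(* $\alpha(W^{\Box 4}_5) \le 343$.
   Context: All graphs are finite and simple. $W_{5}$ denotes the $5$-wheel, the join of the cycle $C_{5}$ with a single vertex $K_1$ (so $W_5$ has $6$ vertices). The Cartesian product $G \Box H$ has vertex set $V(G)\times V(H)$, with $(u,x)$ adjacent to $(v,y)$ if and only if either $u=v$ and $xy\in E(H)$, or $x=y$ and $uv\in E(G)$. Set $G^{\Box 1}=G$ and $G^{\Box k}=G^{\Box (k-1)}\Box G$ for $k\ge 2$. $\alpha(G)$ is the independence number of $G$. *)

theory Defs
  imports "Graph_Theory.Pair_Digraph"
begin

text \<open>
  Finite simple graphs are the symmetric loopfree digraphs of the locale \<^locale>\<open>pair_graph\<close>:
  every edge \<open>uv\<close> is represented by the two arcs \<open>(u, v)\<close> and \<open>(v, u)\<close>.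
\<close>

definition complete_graph :: "nat \<Rightarrow> nat pair_pre_digraph" where
  "complete_graph n =
     \<lparr> pverts = {..<n}, parcs = {(i, j). i < n \<and> j < n \<and> i \<noteq> j} \<rparr>"

text \<open>Only meant for \<open>n \<ge> 3\<close>; for \<open>n = 1\<close> it has a loop.\<close>

definition cycle_graph :: "nat \<Rightarrow> nat pair_pre_digraph" where
  "cycle_graph n =
     \<lparr> pverts = {..<n},
       parcs = {(i, j). i < n \<and> j < n \<and> (j = Suc i mod n \<or> i = Suc j mod n)} \<rparr>"

definition graph_join ::
  "'a pair_pre_digraph \<Rightarrow> 'b pair_pre_digraph \<Rightarrow> ('a + 'b) pair_pre_digraph" where
  "graph_join G H =
     \<lparr> pverts = pverts G <+> pverts H,
       parcs = {(Inl u, Inl v) |u v. (u, v) \<in> parcs G}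
         \<union> {(Inr x, Inr y) |x y. (x, y) \<in> parcs H}
         \<union> {(Inl u, Inr x) |u x. u \<in> pverts G \<and> x \<in> pverts H}
         \<union> {(Inr x, Inl u) |u x. u \<in> pverts G \<and> x \<in> pverts H} \<rparr>"

definition wheel :: "nat \<Rightarrow> (nat + nat) pair_pre_digraph" where
  "wheel n = graph_join (cycle_graph n) (complete_graph 1)"

text \<open>
  The operator associates to the left, so that \<open>G \<box> G \<box> G \<box> G\<close> is literally the unfolding
  of the recursion ``first power is \<open>G\<close>, \<open>k\<close>-th power is the \<open>(k - 1)\<close>-th power times \<open>G\<close>''
  for \<open>k = 4\<close>. The recursion itself changes the vertex type in every step.
\<close>

definition cart_prod ::
  "'a pair_pre_digraph \<Rightarrow> 'b pair_pre_digraph \<Rightarrow> ('a \<times> 'b) pair_pre_digraph" (infixl \<open>\<box>\<close> 70) where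
  "G \<box> H =
     \<lparr> pverts = pverts G \<times> pverts H,
       parcs = {((u, x), (v, y)) |u x v y.
           u \<in> pverts G \<and> v \<in> pverts G \<and> x \<in> pverts H \<and> y \<in> pverts H \<and>
           (u = v \<and> (x, y) \<in> parcs H \<or> x = y \<and> (u, v) \<in> parcs G)} \<rparr>"

definition independent_set :: "'a pair_pre_digraph \<Rightarrow> 'a set \<Rightarrow> bool" where
  "independent_set G S \<longleftrightarrow> S \<subseteq> pverts G \<and> (\<forall>u\<in>S. \<forall>v\<in>S. (u, v) \<notin> parcs G)"

definition independence_number :: "'a pair_pre_digraph \<Rightarrow> nat" where
  "independence_number G = Max (card ` {S. independent_set G S})"


lemma pair_graphI:
  assumes "finite (pverts G)" "parcs G \<subseteq> pverts G \<times> pverts G"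
    "\<And>u v. (u, v) \<in> parcs G \<Longrightarrow> (v, u) \<in> parcs G" "\<And>u. (u, u) \<notin> parcs G"
  shows "pair_graph G"
proof -
  have "finite (parcs G)"
    using assms(1,2) by (meson finite_SigmaI finite_subset)
  moreover have "symmetric (with_proj G)"
    using assms(3) by (auto simp: symmetric_def intro: symI)
  ultimately show ?thesis
    using assms by unfold_locales (auto 4 4 simp: subset_iff split: prod.splits)
qed

lemma pair_graphD:
  assumes "pair_graph G"
  shows "finite (pverts G)" "parcs G \<subseteq> pverts G \<times> pverts G"
    "(u, v) \<in> parcs G \<Longrightarrow> (v, u) \<in> parcs G" "(u, u) \<notin> parcs G"
proof -
  interpret pair_graph G by fact
  show "finite (pverts G)" by simp
  show "parcs G \<subseteq> pverts G \<times> pverts G" by (auto dest: arc_fst_in_verts arc_snd_in_verts)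
  show "(u, v) \<in> parcs G \<Longrightarrow> (v, u) \<in> parcs G"
    using pair_sym_arcs by (auto simp: symmetric_def dest: symD)
  show "(u, u) \<notin> parcs G" using pair_no_loops[of "(u, u)"] by auto
qed

lemma pair_graph_complete_graph: "pair_graph (complete_graph n)"
  by (rule pair_graphI) (auto simp: complete_graph_def)

lemma pair_graph_cycle_graph:
  assumes "n \<ge> 3"
  shows "pair_graph (cycle_graph n)"
  using assms by (intro pair_graphI) (auto simp: cycle_graph_def mod_Suc split: if_splits)

lemma pair_graph_graph_join:
  assumes "pair_graph G" "pair_graph H"
  shows "pair_graph (graph_join G H)"
  using pair_graphD[OF assms(1)] pair_graphD[OF assms(2)]
  by (intro pair_graphI) (auto simp: graph_join_def)

lemma pair_graph_wheel: "n \<ge> 3 \<Longrightarrow> pair_graph (wheel n)"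
  by (simp add: wheel_def pair_graph_graph_join pair_graph_cycle_graph pair_graph_complete_graph)

lemma card_pverts_wheel: "card (pverts (wheel n)) = n + 1"
  by (simp add: wheel_def graph_join_def cycle_graph_def complete_graph_def card_Plus)

lemma pair_graph_cart_prod:
  assumes "pair_graph G" "pair_graph H"
  shows "pair_graph (G \<box> H)"
  using pair_graphD[OF assms(1)] pair_graphD[OF assms(2)]
  by (intro pair_graphI) (auto simp: cart_prod_def)

lemma independence_number_le_iff:
  assumes "pair_graph G"
  shows "independence_number G \<le> m \<longleftrightarrow> (\<forall>S. independent_set G S \<longrightarrow> card S \<le> m)"
proof -
  have "{S. independent_set G S} \<subseteq> Pow (pverts G)"
    by (auto simp: independent_set_def)
  then have "finite {S. independent_set G S}"
    using pair_graphD(1)[OF assms] by (meson finite_Pow_iff finite_subset)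
  moreover have "independent_set G {}"
    by (simp add: independent_set_def)
  ultimately show ?thesis
    unfolding independence_number_def by (subst Max_le_iff) auto
qed

end

theory Submission
  imports Defs
begin

text \<open>
  Give a vertex with \<open>j\<close> hub coordinates the weight \<open>2, 2, 1, 0\<close> (for \<open>j = 0, 1, 2, 3\<close>) in each of the
  20 slices of the independent set obtained by fixing a coordinate to a cycle vertex, and
  \<open>6, 9, 8, 6\<close> in each of the 4 slices with a coordinate fixed to the hub. In an independent set of the
  third power the total weights are at most 110 and 413, and counting the cycle slices six times and
  the hub slices twice gives every vertex the total weight 48, so that
  \<open>48 \<sqdot> |S| \<le> 4 (5 \<sqdot> 6 \<sqdot> 110 + 2 \<sqdot> 413) = 16504 < 48 \<sqdot> 344\<close>.

  The two bounds for the third power come from its planes: if \<open>p\<close>, \<open>r\<close>, \<open>c\<close> count the points of a plane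
  with no hub coordinate, with the first, and with the second one a hub, and \<open>h\<close> counts the point with
  two hub coordinates, then \<open>2p + 3r + 3c + 2h \<le> 22\<close>. Summing over the five parallel planes in each of
  the three directions settles all but a few configurations, in which almost all planes are extremal.
  Extremality is a propositional condition on the 216 points, since a line contains two points of its
  5-cycle iff it meets every three consecutive vertices, and a SAT solver refutes each configuration.
\<close>

section \<open>Extremal configurations\<close>

text \<open>A vertex of the wheel is \<open>None\<close> for the hub and \<open>Some a\<close> for a cycle vertex.\<close>

datatype five = F0 | F1 | F2 | F3 | F4

fun nx :: "five \<Rightarrow> five" where
  "nx F0 = F1" | "nx F1 = F2" | "nx F2 = F3" | "nx F3 = F4" | "nx F4 = F0"

lemma all_five: "(\<forall>a. P a) \<longleftrightarrow> P F0 \<and> P F1 \<and> P F2 \<and> P F3 \<and> P F4"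
  by (metis five.exhaust)

lemma all_option: "(\<forall>x. P x) \<longleftrightarrow> P None \<and> (\<forall>a. P (Some a))"
  by (metis option.exhaust)

definition indep_line :: "(five option \<Rightarrow> bool) \<Rightarrow> bool" where
  "indep_line L \<longleftrightarrow>
     (\<forall>a. \<not> (L (Some a) \<and> L (Some (nx a))) \<and> \<not> (L (Some a) \<and> L None))"

definition indep_plane :: "(five option \<Rightarrow> five option \<Rightarrow> bool) \<Rightarrow> bool" where
  "indep_plane P \<longleftrightarrow> (\<forall>x. indep_line (P x)) \<and> (\<forall>y. indep_line (\<lambda>x. P x y))"

definition indep_cube :: "(five option \<Rightarrow> five option \<Rightarrow> five option \<Rightarrow> bool) \<Rightarrow> bool" where
  "indep_cube Q \<longleftrightarrow> (\<forall>y z. indep_line (\<lambda>x. Q x y z)) \<and>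
     (\<forall>x z. indep_line (\<lambda>y. Q x y z)) \<and> (\<forall>x y. indep_line (\<lambda>z. Q x y z))"

definition full :: "(five \<Rightarrow> bool) \<Rightarrow> bool" where
  "full L \<longleftrightarrow> (\<forall>a. L a \<or> L (nx a) \<or> L (nx (nx a)))"

text \<open>Distinct nonadjacent vertices of a 5-cycle are at distance two, so on an independent
  line the second conjunct excludes every pair and exactly one point remains.\<close>

definition single :: "(five \<Rightarrow> bool) \<Rightarrow> bool" where
  "single L \<longleftrightarrow> (L F0 \<or> L F1 \<or> L F2 \<or> L F3 \<or> L F4) \<and> (\<forall>a. \<not> (L a \<and> L (nx (nx a))))"

text \<open>In an independent plane a row with its hub point has no other point, and any other row
  holds at most two. So this is equality in \<open>row_count_le\<close> for all rows at once, that
  is p + 2c = 10.\<close>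

definition full_rows :: "(five option \<Rightarrow> five option \<Rightarrow> bool) \<Rightarrow> bool" where
  "full_rows P \<longleftrightarrow> (\<forall>a. P (Some a) None \<or> full (\<lambda>b. P (Some a) (Some b)))"

definition full_cols :: "(five option \<Rightarrow> five option \<Rightarrow> bool) \<Rightarrow> bool" where
  "full_cols P \<longleftrightarrow> (\<forall>b. P None (Some b) \<or> full (\<lambda>a. P (Some a) (Some b)))"

text \<open>
  If \<open>a\<close>, \<open>a + 2\<close> are the rows and \<open>b\<close>, \<open>b + 2\<close> the columns blocked by hub points, the remaining
  \<open>3 \<times> 3\<close> grid splits into a single point and four pairs of adjacent points, whence at most five points.
  For the values of \<open>a\<close> below, \<open>grid_row\<close> and \<open>grid_col\<close> are the four pairs.
\<close>

definition grid_corner :: "(five option \<Rightarrow> five option \<Rightarrow> bool) \<Rightarrow> five \<Rightarrow> five \<Rightarrow> bool" where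
  "grid_corner P a b \<longleftrightarrow> P (Some (nx a)) (Some (nx b))"

definition grid_row :: "(five option \<Rightarrow> five option \<Rightarrow> bool) \<Rightarrow> five \<Rightarrow> five \<Rightarrow> bool" where
  "grid_row P a b \<longleftrightarrow> P (Some a) (Some (nx (nx (nx b)))) \<or> P (Some a) (Some (nx (nx (nx (nx b)))))"

definition grid_col :: "(five option \<Rightarrow> five option \<Rightarrow> bool) \<Rightarrow> five \<Rightarrow> five \<Rightarrow> bool" where
  "grid_col P a b \<longleftrightarrow> P (Some (nx (nx (nx a)))) (Some (nx b)) \<or> P (Some (nx (nx (nx (nx a))))) (Some (nx b))"

definition hub_corner :: "(five option \<Rightarrow> five option \<Rightarrow> bool) \<Rightarrow> five \<Rightarrow> five \<Rightarrow> bool" where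
  "hub_corner P a b \<longleftrightarrow> P (Some a) None \<and> P (Some (nx (nx a))) None \<and>
     P None (Some b) \<and> P None (Some (nx (nx b)))"

text \<open>The next three predicates are the equality cases of 2p + 3r + 3c + 2h \<le> 22 in an
  independent plane. The digits are r and c, and p is 5, 8 and 10 in turn.\<close>

definition tight22 :: "(five option \<Rightarrow> five option \<Rightarrow> bool) \<Rightarrow> bool" where
  "tight22 P \<longleftrightarrow> full (\<lambda>b. P None (Some b)) \<and> full (\<lambda>a. P (Some a) None) \<and>
     (\<forall>a b. hub_corner P a b \<longrightarrow> grid_corner P a b \<and> grid_row P (nx a) b \<and> grid_col P a b \<and>
        grid_row P (nx (nx (nx a))) b \<and> grid_row P (nx (nx (nx (nx a)))) b)"

definition tight11 :: "(five option \<Rightarrow> five option \<Rightarrow> bool) \<Rightarrow> bool" where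
  "tight11 P \<longleftrightarrow> single (\<lambda>b. P None (Some b)) \<and> single (\<lambda>a. P (Some a) None) \<and>
     full_rows P \<and> full_cols P"

definition tight00 :: "(five option \<Rightarrow> five option \<Rightarrow> bool) \<Rightarrow> bool" where
  "tight00 P \<longleftrightarrow> P None None \<and> full_rows P \<and> full_cols P"

text \<open>\<open>k\<close> is an explicit case distinction that keeps the clauses for the SAT solver small.\<close>

definition tight_plane :: "(five option \<Rightarrow> five option \<Rightarrow> bool) \<Rightarrow> bool \<Rightarrow> bool" where
  "tight_plane P k \<longleftrightarrow> (P None None \<longrightarrow> tight00 P) \<and> (\<not> P None None \<longrightarrow> k \<longrightarrow> tight22 P) \<and>
     (\<not> P None None \<longrightarrow> \<not> k \<longrightarrow> tight11 P)"

section \<open>Refutations for the slices at cycle vertices\<close>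

lemmas cube_defs = indep_cube_def indep_line_def full_rows_def full_cols_def
  grid_corner_def grid_row_def grid_col_def hub_corner_def tight22_def tight11_def tight00_def
  tight_plane_def single_def full_def all_option all_five nx.simps

text \<open>The digits in this and the next three names are the axis counts for which the refutation
  is used; rotation puts the axis points at \<open>F0\<close> and, if there are two, at
  \<open>F2\<close>. The free predicates \<open>k\<close> and \<open>l\<close> cover every mixture
  of tight types among parallel planes.\<close>

lemma no_tight_111:
  assumes "indep_cube Q"
    "\<forall>x. tight_plane (\<lambda>y z. Q (Some x) y z) (k x)"
    "\<forall>y. tight_plane (\<lambda>x z. Q x (Some y) z) (l y)"
    "Q (Some F0) None None" "Q None (Some F0) None" "Q None None (Some F0)"
  shows False
  using assms unfolding cube_defs by sat

lemma no_tight_222: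
  assumes "indep_cube Q"
    "\<forall>x. tight_plane (\<lambda>y z. Q (Some x) y z) (k x)"
    "Q (Some F0) None None" "Q None (Some F0) None" "Q None None (Some F0)"
    "Q (Some F2) None None" "Q None (Some F2) None" "Q None None (Some F2)"
  shows False
  using assms unfolding cube_defs by sat

lemma no_tight_221:
  assumes "indep_cube Q"
    "\<forall>x. tight_plane (\<lambda>y z. Q (Some x) y z) (k x)"
    "\<forall>y. tight_plane (\<lambda>x z. Q x (Some y) z) (l y)"
    "Q (Some F0) None None" "Q None (Some F0) None" "Q None None (Some F0)"
    "Q (Some F2) None None" "Q None (Some F2) None"
  shows False
  using assms unfolding cube_defs by sat

text \<open>Beside a point at \<open>F0\<close>, a second point of the first axis could only be at
  \<open>F2\<close> or \<open>F3\<close>. The last two hypotheses thus express that the axis count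
  is one.\<close>

lemma no_tight_122:
  assumes "indep_cube Q"
    "\<forall>x. tight_plane (\<lambda>y z. Q (Some x) y z) (k x)"
    "Q (Some F0) None None" "Q None (Some F0) None" "Q None None (Some F0)"
    "Q None (Some F2) None" "Q None None (Some F2)"
    "\<not> (Q (Some F2) None None)" "\<not> (Q (Some F3) None None)"
  shows False
  using assms unfolding cube_defs by sat

section \<open>Refutations for the slices at the hub\<close>

definition near22 :: "(five option \<Rightarrow> five option \<Rightarrow> bool) \<Rightarrow> bool" where
  "near22 P \<longleftrightarrow> full (\<lambda>b. P None (Some b)) \<and> full (\<lambda>a. P (Some a) None) \<and>
     (\<forall>a b. hub_corner P a b \<longrightarrow>
        (grid_corner P a b \<or> grid_row P (nx a) b) \<and>
        (grid_corner P a b \<or> grid_col P a b) \<and>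
        (grid_corner P a b \<or> grid_row P (nx (nx (nx a))) b) \<and>
        (grid_corner P a b \<or> grid_row P (nx (nx (nx (nx a)))) b) \<and>
        (grid_row P (nx a) b \<or> grid_col P a b) \<and>
        (grid_row P (nx a) b \<or> grid_row P (nx (nx (nx a))) b) \<and>
        (grid_row P (nx a) b \<or> grid_row P (nx (nx (nx (nx a)))) b) \<and>
        (grid_col P a b \<or> grid_row P (nx (nx (nx a))) b) \<and>
        (grid_col P a b \<or> grid_row P (nx (nx (nx (nx a)))) b) \<and>
        (grid_row P (nx (nx (nx a))) b \<or> grid_row P (nx (nx (nx (nx a)))) b))"

text \<open>Any two distinct vertices of a 5-cycle are at distance one or two, so all pairs are
  excluded.\<close>

definition at_most_one :: "(five \<Rightarrow> bool) \<Rightarrow> bool" where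
  "at_most_one e \<longleftrightarrow> (\<forall>a. \<not> (e a \<and> e (nx a)) \<and> \<not> (e a \<and> e (nx (nx a))))"

definition nonempty :: "(five \<Rightarrow> bool) \<Rightarrow> bool" where
  "nonempty L \<longleftrightarrow> L F0 \<or> L F1 \<or> L F2 \<or> L F3 \<or> L F4"

text \<open>Nine points are one short of ten, so one row and one column have a single point and all
  others have two. The exceptions are marked by predicates, which can be fixed at a vertex or stay
  unknown to the SAT solver.\<close>

definition nine :: "(five option \<Rightarrow> five option \<Rightarrow> bool) \<Rightarrow> (five \<Rightarrow> bool) \<Rightarrow> (five \<Rightarrow> bool) \<Rightarrow> bool" where
  "nine P e f \<longleftrightarrow> at_most_one e \<and> at_most_one f \<and>
     (\<forall>a. nonempty (\<lambda>b. P (Some a) (Some b))) \<and> (\<forall>b. nonempty (\<lambda>a. P (Some a) (Some b))) \<and>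
     (\<forall>a. e a \<or> full (\<lambda>b. P (Some a) (Some b))) \<and>
     (\<forall>b. f b \<or> full (\<lambda>a. P (Some a) (Some b)))"

lemmas cube_defs' = near22_def at_most_one_def nonempty_def nine_def cube_defs five.distinct five.distinct[symmetric]
  refl simp_thms

text \<open>Each face has ten points. Up to rotation, this lemma and the next cover all ways in
  which five planes of at most five points lose at most two points in total.\<close>

lemma no_full_013:
  assumes "indep_cube Q" "full_rows (Q None)" "full_cols (Q None)"
    "full_rows (\<lambda>x z. Q x None z)" "full_cols (\<lambda>x z. Q x None z)"
    "full_rows (\<lambda>x y. Q x y None)" "full_cols (\<lambda>x y. Q x y None)"
    "\<forall>a. \<not> Q None (Some a) None" "\<forall>a. \<not> Q None None (Some a)" "\<forall>a. \<not> Q (Some a) None None"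
    "tight22 (Q (Some F0))" "tight22 (Q (Some F1))" "tight22 (Q (Some F3))"
  shows False
  using assms unfolding cube_defs' by sat

text \<open>This is the case of two defects in adjacent planes. \<open>near22\<close> allows one of
  the five grid pieces to be missed, since it demands a met piece among any two.\<close>

lemma no_full_near:
  assumes "indep_cube Q" "full_rows (Q None)" "full_cols (Q None)"
    "full_rows (\<lambda>x z. Q x None z)" "full_cols (\<lambda>x z. Q x None z)"
    "full_rows (\<lambda>x y. Q x y None)" "full_cols (\<lambda>x y. Q x y None)"
    "\<forall>a. \<not> Q None (Some a) None" "\<forall>a. \<not> Q None None (Some a)" "\<forall>a. \<not> Q (Some a) None None"
    "tight22 (Q (Some F0))" "tight22 (Q (Some F1))" "tight22 (Q (Some F2))"
    "near22 (Q (Some F3))" "near22 (Q (Some F4))"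
  shows False
  using assms unfolding cube_defs' by sat

lemma no_nine_10_10:
  assumes "indep_cube Q" "nine (Q None) (\<lambda>a. a = F0) (\<lambda>a. a = F0)"
    "full_rows (\<lambda>x z. Q x None z)" "full_cols (\<lambda>x z. Q x None z)"
    "full_rows (\<lambda>x y. Q x y None)" "full_cols (\<lambda>x y. Q x y None)"
    "\<forall>a. \<not> Q None (Some a) None" "\<forall>a. \<not> Q None None (Some a)" "\<forall>a. \<not> Q (Some a) None None"
    "\<forall>x. tight22 (Q (Some x))"
  shows False
  using assms unfolding cube_defs' by sat

lemma no_nine_nine_nine:
  assumes "indep_cube Q" "nine (\<lambda>x z. Q x None z) (\<lambda>a. a = F0) (\<lambda>a. a = F0)" "nine (\<lambda>x y. Q x y None) (\<lambda>a. a = F0) (\<lambda>a. a = F0)"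
    "tight11 (Q (Some F0))" "\<forall>x. x = F0 \<or> tight22 (Q (Some x))"
    "nine (Q None) e f"
    "\<forall>a. \<not> Q None (Some a) None" "\<forall>a. \<not> Q None None (Some a)" "\<forall>a. \<not> Q (Some a) None None"
  shows False
  using assms unfolding cube_defs' by sat

lemma no_nine_nine_10:
  assumes "indep_cube Q"
    "full_rows (\<lambda>x y. Q x y None)" "full_cols (\<lambda>x y. Q x y None)"
    "\<forall>x. x = F0 \<or> tight22 (Q (Some x))"
    "\<forall>y. y = F0 \<or> tight22 (\<lambda>x z. Q x (Some y) z)"
    "single (\<lambda>z. Q (Some F0) None (Some z))" "single (\<lambda>z. Q None (Some F0) (Some z))"
    "full_rows (Q (Some F0))" "full_rows (\<lambda>x z. Q x (Some F0) z)"
    "nine (Q None) (\<lambda>a. a = F0) e" "nine (\<lambda>x z. Q x None z) (\<lambda>a. a = F0) f"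
    "\<forall>a. \<not> Q None (Some a) None" "\<forall>a. \<not> Q None None (Some a)" "\<forall>a. \<not> Q (Some a) None None"
  shows False
  using assms unfolding cube_defs' by sat

text \<open>Each axis has one point and each face eight. This lemma and the next two cover the ways
  in which the planes at cycle vertices are at most one point short of their maximum 10 + 4 *
  5.\<close>

lemma no_eight_1:
  assumes "indep_cube Q" "full_rows (Q None)" "full_cols (Q None)"
    "full_rows (\<lambda>x z. Q x None z)" "full_cols (\<lambda>x z. Q x None z)"
    "full_rows (\<lambda>x y. Q x y None)" "full_cols (\<lambda>x y. Q x y None)"
    "Q (Some F0) None None" "Q None (Some F0) None" "Q None None (Some F0)"
    "tight00 (Q (Some F0))" "tight22 (Q (Some F1))"
  shows False
  using assms unfolding cube_defs' by sat

lemma no_eight_4: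
  assumes "indep_cube Q" "full_rows (Q None)" "full_cols (Q None)"
    "full_rows (\<lambda>x z. Q x None z)" "full_cols (\<lambda>x z. Q x None z)"
    "full_rows (\<lambda>x y. Q x y None)" "full_cols (\<lambda>x y. Q x y None)"
    "Q (Some F0) None None" "Q None (Some F0) None" "Q None None (Some F0)"
    "tight00 (Q (Some F0))" "tight22 (Q (Some F4))"
  shows False
  using assms unfolding cube_defs' by sat

lemma no_eight_2:
  assumes "indep_cube Q" "full_rows (Q None)" "full_cols (Q None)"
    "full_rows (\<lambda>x z. Q x None z)" "full_cols (\<lambda>x z. Q x None z)"
    "full_rows (\<lambda>x y. Q x y None)" "full_cols (\<lambda>x y. Q x y None)"
    "Q (Some F0) None None" "Q None (Some F0) None" "Q None None (Some F0)"
    "nine (Q (Some F0)) e f" "tight22 (Q (Some F1))" "tight22 (Q (Some F4))"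
  shows False
  using assms unfolding cube_defs' by sat

section \<open>Counting in lines and planes\<close>

lemma UNIV_five: "(UNIV :: five set) = {F0, F1, F2, F3, F4}"
  using five.exhaust by blast

lemma finite_five [simp]: "finite (UNIV :: five set)"
  by (simp add: UNIV_five)

lemma sum_five: "sum f (UNIV :: five set) = f F0 + f F1 + f F2 + f F3 + f F4"
  by (simp add: UNIV_five add.assoc)

lemma nx_5 [simp]: "nx (nx (nx (nx (nx a)))) = a"
  by (cases a) simp_all

text \<open>Starting the sum at an arbitrary vertex allows counting relative to a hub point or an
  exceptional plane wherever it lies.\<close>

lemma sum_five_rotate:
  fixes f :: "five \<Rightarrow> nat"
  shows "sum f UNIV = f a + f (nx a) + f (nx (nx a)) + f (nx (nx (nx a))) + f (nx (nx (nx (nx a))))"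
  by (cases a) (simp_all add: sum_five)

definition line_count :: "(five \<Rightarrow> bool) \<Rightarrow> nat" where
  "line_count L = (\<Sum>a\<in>UNIV. of_bool (L a))"

lemma line_count_rotate:
  "line_count L = of_bool (L a) + of_bool (L (nx a)) + of_bool (L (nx (nx a))) +
     of_bool (L (nx (nx (nx a)))) + of_bool (L (nx (nx (nx (nx a)))))"
  by (simp add: line_count_def sum_five_rotate[of _ a])

definition plane_count :: "(five option \<Rightarrow> five option \<Rightarrow> bool) \<Rightarrow> nat" where
  "plane_count P = (\<Sum>a\<in>UNIV. line_count (\<lambda>b. P (Some a) (Some b)))"

lemma plane_count_transpose: "plane_count (\<lambda>x y. P y x) = plane_count P"
  unfolding plane_count_def line_count_def by (rule sum.swap)

lemma indep_plane_transpose: "indep_plane P \<Longrightarrow> indep_plane (\<lambda>x y. P y x)"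
  by (simp add: indep_plane_def)

context
  fixes L assumes L: "indep_line L"
begin

lemma indep_lineD: "L (Some a) \<Longrightarrow> \<not> L (Some (nx a))" "L (Some a) \<Longrightarrow> \<not> L None"
  using L by (auto simp: indep_line_def)

lemma line_count_le: "line_count (\<lambda>a. L (Some a)) + 2 * of_bool (L None) \<le> 2"
  using L by (cases "L None"; cases "L (Some F0)"; cases "L (Some F1)"; cases "L (Some F2)"; cases "L (Some F3)"; cases "L (Some F4)";
      simp add: indep_line_def all_five line_count_def sum_five)

lemma line_count_eq_2: "line_count (\<lambda>a. L (Some a)) = 2 \<Longrightarrow> full (\<lambda>a. L (Some a))"
  using L by (cases "L (Some F0)"; cases "L (Some F1)"; cases "L (Some F2)"; cases "L (Some F3)"; cases "L (Some F4)";
      simp add: indep_line_def all_five line_count_def sum_five full_def)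

lemma line_count_eq_1: "line_count (\<lambda>a. L (Some a)) = 1 \<Longrightarrow> single (\<lambda>a. L (Some a))"
  using L by (cases "L (Some F0)"; cases "L (Some F1)"; cases "L (Some F2)"; cases "L (Some F3)"; cases "L (Some F4)";
      simp add: indep_line_def all_five line_count_def sum_five single_def)

lemma line_count_pos: "line_count (\<lambda>a. L (Some a)) > 0 \<Longrightarrow> nonempty (\<lambda>a. L (Some a))"
  by (auto simp: line_count_def sum_five nonempty_def)

lemma line_count_2_obtain:
  assumes "line_count (\<lambda>a. L (Some a)) = 2" obtains a where "L (Some a)" "L (Some (nx (nx a)))"
proof -
  have "\<not> (\<forall>a. \<not> (L (Some a) \<and> L (Some (nx (nx a)))))"
    using L assms by (cases "L (Some F0)"; cases "L (Some F1)"; cases "L (Some F2)"; cases "L (Some F3)"; cases "L (Some F4)";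
      simp add: indep_line_def all_five line_count_def sum_five)
  then show thesis using that by blast
qed

end

lemma line_count_1_obtain:
  assumes "line_count L = 1" obtains a where "L a"
  using assms unfolding line_count_def sum_five
  by (metis (full_types) add_0 of_bool_eq(1) zero_neq_one)

context
  fixes P assumes P: "indep_plane P"
begin

lemma indep_plane_row: "indep_line (P x)" and indep_plane_col: "indep_line (\<lambda>x. P x y)"
  using P by (auto simp: indep_plane_def)

lemma row_count_le:
  "line_count (\<lambda>b. P (Some a) (Some b)) + 2 * of_bool (P (Some a) None) \<le> 2"
  by (rule line_count_le) (rule indep_plane_row)

lemma plane_count_le_rows: "plane_count P + 2 * line_count (\<lambda>a. P (Some a) None) \<le> 10"
  using row_count_le[of F0] row_count_le[of F1] row_count_le[of F2] row_count_le[of F3] row_count_le[of F4]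
  unfolding plane_count_def sum_five line_count_def[of "\<lambda>a. P (Some a) None"] distrib_left
  by linarith

lemma full_rows_if_count_eq:
  assumes "plane_count P + 2 * line_count (\<lambda>a. P (Some a) None) = 10"
  shows "full_rows P"
proof -
  have "line_count (\<lambda>b. P (Some a) (Some b)) + 2 * of_bool (P (Some a) None) = 2" for a
    using row_count_le[of F0] row_count_le[of F1] row_count_le[of F2] row_count_le[of F3]
      row_count_le[of F4] assms
    unfolding plane_count_def sum_five line_count_def[of "\<lambda>a. P (Some a) None"] distrib_left
    by (cases a; hypsubst; linarith)
  then have "line_count (\<lambda>b. P (Some a) (Some b)) = 2" if "\<not> P (Some a) None" for a
    using that by (metis (full_types) add.right_neutral mult_0_right of_bool_eq(1))
  then show ?thesis
    unfolding full_rows_def using line_count_eq_2[OF indep_plane_row] by blast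
qed

lemma hub_counts_le: "line_count (\<lambda>b. P None (Some b)) \<le> 2" "line_count (\<lambda>a. P (Some a) None) \<le> 2"
  using line_count_le[OF indep_plane_row[of None]] line_count_le[OF indep_plane_col[of None]]
  by linarith+

lemma hub_counts_eq_0:
  assumes "P None None"
  shows "line_count (\<lambda>b. P None (Some b)) = 0" "line_count (\<lambda>a. P (Some a) None) = 0"
  using line_count_le[OF indep_plane_row[of None]] line_count_le[OF indep_plane_col[of None]] assms
  by auto

text \<open>The lines through the four hub points hold no cycle points. Of two adjacent points at
  most one is present, so each pair contributes the truth value of its disjunction.\<close>

lemma plane_count_22:
  assumes "hub_corner P a b"
  shows "plane_count P = of_bool (grid_corner P a b) + of_bool (grid_row P (nx a) b) +
    of_bool (grid_col P a b) + of_bool (grid_row P (nx (nx (nx a))) b) +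
    of_bool (grid_row P (nx (nx (nx (nx a)))) b)"
proof -
  have excl: "\<not> (P (Some x) (Some y) \<and> P (Some x) (Some (nx y)))"
       "\<not> (P (Some x) (Some y) \<and> P (Some (nx x)) (Some y))" for x y
    using indep_lineD(1)[OF indep_plane_row] indep_lineD(1)[OF indep_plane_col] by blast+
  have kill: "P (Some x) None \<Longrightarrow> \<not> P (Some x) (Some y)"
       "P None (Some y) \<Longrightarrow> \<not> P (Some x) (Some y)" for x y
    using indep_lineD(2)[OF indep_plane_row] indep_lineD(2)[OF indep_plane_col] by blast+
  have disj: "of_bool (p \<or> q) = of_bool p + (of_bool q :: nat)" if "\<not> (p \<and> q)" for p q
    using that by (cases p; cases q) simp_all
  have hub: "P (Some a) None" "P (Some (nx (nx a))) None" "P None (Some b)" "P None (Some (nx (nx b)))"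
    using assms unfolding hub_corner_def by auto
  note zero = kill(1)[OF hub(1)] kill(1)[OF hub(2)] kill(2)[OF hub(3)] kill(2)[OF hub(4)]
  show ?thesis
    unfolding plane_count_def sum_five_rotate[of _ a] line_count_rotate[of _ b]
      grid_corner_def grid_row_def grid_col_def disj[OF excl(1)] disj[OF excl(2)]
    by (simp add: zero)
qed

lemma hub_corner_obtain:
  assumes "line_count (\<lambda>b. P None (Some b)) = 2" "line_count (\<lambda>a. P (Some a) None) = 2"
  obtains a b where "hub_corner P a b"
  using line_count_2_obtain[OF indep_plane_row assms(1)] line_count_2_obtain[OF indep_plane_col assms(2)]
  unfolding hub_corner_def by metis

lemma plane_count_22_cases:
  assumes "line_count (\<lambda>b. P None (Some b)) = 2" "line_count (\<lambda>a. P (Some a) None) = 2"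
  shows plane_count_22_le: "plane_count P \<le> 5"
    and tight22I: "plane_count P \<ge> 5 \<Longrightarrow> tight22 P"
    and near22I: "plane_count P \<ge> 4 \<Longrightarrow> near22 P"
proof -
  have five: "of_bool p + of_bool q + of_bool r + of_bool s + of_bool t \<le> (5::nat)"
      "of_bool p + of_bool q + of_bool r + of_bool s + of_bool t \<ge> (5::nat) \<Longrightarrow> p \<and> q \<and> r \<and> s \<and> t"
      "of_bool p + of_bool q + of_bool r + of_bool s + of_bool t \<ge> (4::nat) \<Longrightarrow>
        (p \<or> q) \<and> (p \<or> r) \<and> (p \<or> s) \<and> (p \<or> t) \<and> (q \<or> r) \<and> (q \<or> s) \<and> (q \<or> t) \<and>
        (r \<or> s) \<and> (r \<or> t) \<and> (s \<or> t)" for p q r s t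
    by (cases p; cases q; cases r; cases s; cases t; simp)+
  obtain a b where "hub_corner P a b"
    by (rule hub_corner_obtain[OF assms])
  from plane_count_22[OF this] show "plane_count P \<le> 5"
    using five(1) by presburger
  have full: "full (\<lambda>b. P None (Some b))" "full (\<lambda>a. P (Some a) None)"
    using line_count_eq_2[OF indep_plane_row assms(1)] line_count_eq_2[OF indep_plane_col assms(2)] .
  show "tight22 P" if *: "plane_count P \<ge> 5"
    unfolding tight22_def
  proof (intro conjI full allI impI)
    \<comment> \<open>The condition is required at every hub corner, so the count is expanded anew
      at this one.\<close>
    fix a b assume "hub_corner P a b"
    note five(2)[OF *[unfolded plane_count_22[OF this]]]
    then show "grid_corner P a b" "grid_row P (nx a) b" "grid_col P a b"
      "grid_row P (nx (nx (nx a))) b" "grid_row P (nx (nx (nx (nx a)))) b" by blast+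
  qed
  show "near22 P" if *: "plane_count P \<ge> 4"
    unfolding near22_def
  proof (intro conjI[OF full(1)] conjI[OF full(2)] allI impI)
    fix a b assume "hub_corner P a b"
    note five(3)[OF *[unfolded plane_count_22[OF this]]]
    then show "(grid_corner P a b \<or> grid_row P (nx a) b) \<and>
        (grid_corner P a b \<or> grid_col P a b) \<and>
        (grid_corner P a b \<or> grid_row P (nx (nx (nx a))) b) \<and>
        (grid_corner P a b \<or> grid_row P (nx (nx (nx (nx a)))) b) \<and>
        (grid_row P (nx a) b \<or> grid_col P a b) \<and>
        (grid_row P (nx a) b \<or> grid_row P (nx (nx (nx a))) b) \<and>
        (grid_row P (nx a) b \<or> grid_row P (nx (nx (nx (nx a)))) b) \<and>
        (grid_col P a b \<or> grid_row P (nx (nx (nx a))) b) \<and>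
        (grid_col P a b \<or> grid_row P (nx (nx (nx (nx a)))) b) \<and>
        (grid_row P (nx (nx (nx a))) b \<or> grid_row P (nx (nx (nx (nx a)))) b)"
      by blast
  qed
qed

end

context
  fixes P assumes P: "indep_plane P"
begin

lemma plane_count_le_cols: "plane_count P + 2 * line_count (\<lambda>b. P None (Some b)) \<le> 10"
  using plane_count_le_rows[OF indep_plane_transpose[OF P]] by (simp add: plane_count_transpose[of P])

lemma full_cols_if_count_eq:
  assumes "plane_count P + 2 * line_count (\<lambda>b. P None (Some b)) = 10"
  shows "full_cols P"
  using full_rows_if_count_eq[OF indep_plane_transpose[OF P]] assms
  by (simp add: plane_count_transpose[of P] full_cols_def full_rows_def)

text \<open>With m the larger of r and c, p \<le> 10 - 2m. If r and c differ, then h = 0 and the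
  weight is at most 20 - 4m + 3(2m - 1) = 17 + 2m \<le> 21. If r = c, it is at most 20 + 2h, 22 and,
  by p \<le> 5 for r = c = 2, again 22.\<close>

lemma plane_weight:
  fixes p r c h :: nat
  defines "p \<equiv> plane_count P" and "r \<equiv> line_count (\<lambda>b. P None (Some b))"
    and "c \<equiv> line_count (\<lambda>a. P (Some a) None)" and "h \<equiv> of_bool (P None None)"
  shows plane_weight_le: "2 * p + 3 * r + 3 * c + 2 * h \<le> 22"
    and plane_weight_eq: "2 * p + 3 * r + 3 * c + 2 * h = 22 \<Longrightarrow> tight_plane P (r = 2)"
proof -
  have rc: "r \<le> 2" "c \<le> 2" "p + 2 * r \<le> 10" "p + 2 * c \<le> 10"
    using hub_counts_le[OF P] plane_count_le_rows[OF P] plane_count_le_cols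
    unfolding p_def r_def c_def by blast+
  have 22: "r = 2 \<and> c = 2 \<longrightarrow> p \<le> 5"
    using plane_count_22_le[OF P] unfolding p_def r_def c_def by blast
  have h: "h = 0 \<or> h = 1 \<and> r = 0 \<and> c = 0"
    using hub_counts_eq_0[OF P] unfolding r_def c_def h_def by (cases "P None None") simp_all
  have r: "r = 0 \<or> r = 1 \<or> r = 2" and c: "c = 0 \<or> c = 1 \<or> c = 2"
    using rc(1,2) by linarith+
  show "2 * p + 3 * r + 3 * c + 2 * h \<le> 22"
    using rc(3,4) 22 h r c by (elim disjE conjE; simp)
  assume "2 * p + 3 * r + 3 * c + 2 * h = 22"
  then have "h = 0 \<and> r = 2 \<and> c = 2 \<and> p = 5 \<or> h = 0 \<and> r = 1 \<and> c = 1 \<and> p = 8 \<or>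
      h = 1 \<and> r = 0 \<and> c = 0 \<and> p = 10"
    using rc(3,4) 22 h r c by (elim disjE conjE; simp)
  then show "tight_plane P (r = 2)"
  proof (elim disjE conjE)
    assume "h = 0" "r = 2" "c = 2" "p = 5"
    then show ?thesis
      using tight22I[OF P] by (auto simp: tight_plane_def assms)
  next
    assume "h = 0" "r = 1" "c = 1" "p = 8"
    then show ?thesis
      using line_count_eq_1[OF indep_plane_row[OF P, of None]] line_count_eq_1[OF indep_plane_col[OF P, of None]]
        full_rows_if_count_eq[OF P] full_cols_if_count_eq
      by (auto simp: tight_plane_def tight11_def assms)
  next
    assume "h = 1" "r = 0" "c = 0" "p = 10"
    then show ?thesis
      using full_rows_if_count_eq[OF P] full_cols_if_count_eq
      by (auto simp: tight_plane_def tight00_def assms)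
  qed
qed

end

section \<open>Slices with a cycle coordinate\<close>

type_synonym cube = "five option \<Rightarrow> five option \<Rightarrow> five option \<Rightarrow> bool"

definition cube_count :: "cube \<Rightarrow> nat" where
  "cube_count Q = (\<Sum>x\<in>UNIV. plane_count (Q (Some x)))"

definition face1 :: "cube \<Rightarrow> nat" where "face1 Q = plane_count (Q None)"
definition face2 :: "cube \<Rightarrow> nat" where "face2 Q = plane_count (\<lambda>x z. Q x None z)"
definition face3 :: "cube \<Rightarrow> nat" where "face3 Q = plane_count (\<lambda>x y. Q x y None)"
definition axis1 :: "cube \<Rightarrow> nat" where "axis1 Q = line_count (\<lambda>x. Q (Some x) None None)"
definition axis2 :: "cube \<Rightarrow> nat" where "axis2 Q = line_count (\<lambda>y. Q None (Some y) None)"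
definition axis3 :: "cube \<Rightarrow> nat" where "axis3 Q = line_count (\<lambda>z. Q None None (Some z))"

lemmas count_defs = face1_def face2_def face3_def axis1_def axis2_def axis3_def

section \<open>Coordinate permutations and rotations of a cube\<close>

definition swap12 :: "cube \<Rightarrow> cube" where "swap12 Q = (\<lambda>x y z. Q y x z)"
definition swap23 :: "cube \<Rightarrow> cube" where "swap23 Q = (\<lambda>x y z. Q x z y)"

text \<open>The two transpositions generate all permutations of the coordinates, so it suffices to
  argue in one direction or for sorted axis counts.\<close>

lemma swap12_counts [simp]:
  "cube_count (swap12 Q) = cube_count Q"
  "face1 (swap12 Q) = face2 Q" "face2 (swap12 Q) = face1 Q" "face3 (swap12 Q) = face3 Q"
  "axis1 (swap12 Q) = axis2 Q" "axis2 (swap12 Q) = axis1 Q" "axis3 (swap12 Q) = axis3 Q"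
  "swap12 Q None None None = Q None None None"
  unfolding count_defs swap12_def cube_count_def
  using plane_count_transpose[of "\<lambda>x y. Q x y None"]
  by (simp_all add: plane_count_def, intro sum.swap)

lemma swap23_counts [simp]:
  "cube_count (swap23 Q) = cube_count Q"
  "face1 (swap23 Q) = face1 Q" "face2 (swap23 Q) = face3 Q" "face3 (swap23 Q) = face2 Q"
  "axis1 (swap23 Q) = axis1 Q" "axis2 (swap23 Q) = axis3 Q" "axis3 (swap23 Q) = axis2 Q"
  "swap23 Q None None None = Q None None None"
  unfolding count_defs swap23_def cube_count_def
  by (simp_all only: plane_count_transpose[of "Q _"])

lemma swap_indep [simp]:
  assumes "indep_cube Q"
  shows "indep_cube (swap12 Q)" "indep_cube (swap23 Q)"
  using assms by (auto simp: indep_cube_def swap12_def swap23_def)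

text \<open>Rotation of the 5-cycle taking \<open>F0\<close> to \<open>i\<close>, used to normalise
  positions to the constants in the SAT lemmas.\<close>

fun shift :: "five \<Rightarrow> five \<Rightarrow> five" where
  "shift F0 a = a" |
  "shift F1 a = nx a" |
  "shift F2 a = nx (nx a)" |
  "shift F3 a = nx (nx (nx a))" |
  "shift F4 a = nx (nx (nx (nx a)))"

lemma shift_F0 [simp]: "shift i F0 = i"
  by (cases i) simp_all

lemma shift_nx [simp]: "shift i (nx a) = nx (shift i a)"
  by (cases i) simp_all

lemma shift_F2 [simp]: "shift i F2 = nx (nx i)"
  by (cases i) simp_all

lemma sum_shift: "(\<Sum>a\<in>UNIV. f (shift i a)) = (\<Sum>a\<in>UNIV. f a :: nat)"
  by (cases i) (simp_all add: sum_five)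

definition shift_cube :: "five \<Rightarrow> five \<Rightarrow> five \<Rightarrow> cube \<Rightarrow> cube" where
  "shift_cube i j k Q =
     (\<lambda>x y z. Q (map_option (shift i) x) (map_option (shift j) y) (map_option (shift k) z))"

lemma shift_cube_counts [simp]:
  "cube_count (shift_cube i j k Q) = cube_count Q"
  "face1 (shift_cube i j k Q) = face1 Q" "face2 (shift_cube i j k Q) = face2 Q"
  "face3 (shift_cube i j k Q) = face3 Q"
  "axis1 (shift_cube i j k Q) = axis1 Q" "axis2 (shift_cube i j k Q) = axis2 Q"
  "axis3 (shift_cube i j k Q) = axis3 Q"
proof -
  have line: "line_count (\<lambda>a. L (shift i a)) = line_count L" for L i
    unfolding line_count_def by (rule sum_shift[of "\<lambda>a. of_bool (L a)"])
  have plane: "plane_count (\<lambda>x y. P (map_option (shift i) x) (map_option (shift j) y)) = plane_count P"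
    for P i j
    unfolding plane_count_def option.map
      line[of "\<lambda>b. P (Some (shift i _)) (Some b)"]
    by (rule sum_shift[of "\<lambda>a. line_count (\<lambda>b. P (Some a) (Some b))"])
  show "face1 (shift_cube i j k Q) = face1 Q" "face2 (shift_cube i j k Q) = face2 Q"
    "face3 (shift_cube i j k Q) = face3 Q" "axis1 (shift_cube i j k Q) = axis1 Q"
    "axis2 (shift_cube i j k Q) = axis2 Q" "axis3 (shift_cube i j k Q) = axis3 Q"
    unfolding count_defs shift_cube_def option.map
    by (rule plane line)+
  show "cube_count (shift_cube i j k Q) = cube_count Q"
    unfolding cube_count_def shift_cube_def option.map plane[of "Q (Some (shift i _))"]
    by (rule sum_shift[of "\<lambda>x. plane_count (Q (Some x))"])
qed

lemma indep_line_shift: "indep_line L \<Longrightarrow> indep_line (\<lambda>x. L (map_option (shift i) x))"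
  by (simp add: indep_line_def)

lemma shift_cube_indep [simp]: "indep_cube Q \<Longrightarrow> indep_cube (shift_cube i j k Q)"
  unfolding indep_cube_def shift_cube_def
  by (elim conjE, intro conjI allI)
    (rule indep_line_shift[of "\<lambda>x. Q x _ _"] indep_line_shift[of "\<lambda>y. Q _ y _"]
      indep_line_shift[of "Q _ _"]; blast)+

lemma shift_cube_hubs [simp]:
  "shift_cube i j k Q (Some F0) None None = Q (Some i) None None"
  "shift_cube i j k Q None (Some F0) None = Q None (Some j) None"
  "shift_cube i j k Q None None (Some F0) = Q None None (Some k)"
  "shift_cube i j k Q (Some F2) None None = Q (Some (nx (nx i))) None None"
  "shift_cube i j k Q None (Some F2) None = Q None (Some (nx (nx j))) None"
  "shift_cube i j k Q None None (Some F2) = Q None None (Some (nx (nx k)))"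
  by (simp_all add: shift_cube_def)

section \<open>Weight bounds summed over parallel planes\<close>

lemma indep_cube_planes:
  assumes "indep_cube Q"
  shows "indep_plane (Q x)" "indep_plane (\<lambda>x z. Q x y z)" "indep_plane (\<lambda>x y. Q x y z)"
  using assms by (auto simp: indep_cube_def indep_plane_def)

text \<open>For the plane at \<open>x\<close>, the counts p, r, c and h are its shares of
  \<open>cube_count\<close>, \<open>face2\<close>, \<open>face3\<close> and \<open>axis1\<close>.
  Five planes of weight at most 22 give 110, and equality of the sum forces equality in each
  plane.\<close>

lemma direction1:
  assumes Q: "indep_cube Q"
  shows direction1_le: "2 * cube_count Q + 3 * (face2 Q + face3 Q) + 2 * axis1 Q \<le> 110"
    and direction1_tight: "2 * cube_count Q + 3 * (face2 Q + face3 Q) + 2 * axis1 Q = 110 \<Longrightarrow>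
      tight_plane (Q (Some x)) (line_count (\<lambda>z. Q (Some x) None (Some z)) = 2)"
proof -
  define f where "f x = 2 * plane_count (Q (Some x)) + 3 * line_count (\<lambda>z. Q (Some x) None (Some z)) +
    3 * line_count (\<lambda>y. Q (Some x) (Some y) None) + 2 * of_bool (Q (Some x) None None)" for x
  have sum: "2 * cube_count Q + 3 * (face2 Q + face3 Q) + 2 * axis1 Q = sum f UNIV"
    unfolding f_def cube_count_def count_defs plane_count_def[of "\<lambda>x z. Q x None z"]
      plane_count_def[of "\<lambda>x y. Q x y None"] line_count_def[of "\<lambda>x. Q (Some x) None None"]
      by (simp add: sum.distrib distrib_left flip: sum_distrib_left)
  have le: "f x \<le> 22" for x
    unfolding f_def by (rule plane_weight_le) (rule indep_cube_planes[OF Q])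
  show "2 * cube_count Q + 3 * (face2 Q + face3 Q) + 2 * axis1 Q \<le> 110"
    unfolding sum sum_five using le[of F0] le[of F1] le[of F2] le[of F3] le[of F4] by linarith
  assume "2 * cube_count Q + 3 * (face2 Q + face3 Q) + 2 * axis1 Q = 110"
  then have "f x = 22"
    unfolding sum sum_five_rotate[of _ x]
    using le[of x] le[of "nx x"] le[of "nx (nx x)"] le[of "nx (nx (nx x))"] le[of "nx (nx (nx (nx x)))"]
    by linarith
  then show "tight_plane (Q (Some x)) (line_count (\<lambda>z. Q (Some x) None (Some z)) = 2)"
    unfolding f_def by (rule plane_weight_eq[OF indep_cube_planes(1)[OF Q]])
qed

lemma direction2:
  assumes Q: "indep_cube Q"
  shows direction2_le: "2 * cube_count Q + 3 * (face1 Q + face3 Q) + 2 * axis2 Q \<le> 110"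
    and direction2_tight: "2 * cube_count Q + 3 * (face1 Q + face3 Q) + 2 * axis2 Q = 110 \<Longrightarrow>
      tight_plane (\<lambda>x z. Q x (Some y) z) (line_count (\<lambda>z. Q None (Some y) (Some z)) = 2)"
  using direction1[OF swap_indep(1)[OF Q]] unfolding swap12_counts unfolding swap12_def by blast+

lemma direction3_le:
  assumes Q: "indep_cube Q"
  shows "2 * cube_count Q + 3 * (face1 Q + face2 Q) + 2 * axis3 Q \<le> 110"
  using direction2_le[OF swap_indep(2)[OF Q]] by simp

lemma face1_bounds:
  assumes "indep_cube Q"
  shows "axis1 Q \<le> 2" "face1 Q + 2 * axis2 Q \<le> 10" "face1 Q + 2 * axis3 Q \<le> 10"
    "axis2 Q = 2 \<Longrightarrow> axis3 Q = 2 \<Longrightarrow> face1 Q \<le> 5"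
proof -
  note P = indep_cube_planes(1)[OF assms, of None]
  show "axis1 Q \<le> 2"
    unfolding axis1_def using hub_counts_le(2)[OF indep_cube_planes(2)[OF assms, of None]] .
  show "face1 Q + 2 * axis2 Q \<le> 10" "face1 Q + 2 * axis3 Q \<le> 10"
    "axis2 Q = 2 \<Longrightarrow> axis3 Q = 2 \<Longrightarrow> face1 Q \<le> 5"
    unfolding count_defs
    using plane_count_le_rows[OF P] plane_count_le_cols[OF P] plane_count_22_le[OF P] by blast+
qed

text \<open>Two points on an independent axis are two steps apart, so rotating the first to
  \<open>F0\<close> brings the second to \<open>F2\<close>. The counts are invariant under
  rotation.\<close>

lemma cube_hub_obtain:
  assumes "indep_cube Q"
  obtains R where "indep_cube R" "cube_count R = cube_count Q" "face1 R = face1 Q"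
    "face2 R = face2 Q" "face3 R = face3 Q" "axis1 R = axis1 Q" "axis2 R = axis2 Q" "axis3 R = axis3 Q"
    "axis1 Q \<ge> 1 \<Longrightarrow> R (Some F0) None None" "axis2 Q \<ge> 1 \<Longrightarrow> R None (Some F0) None"
    "axis3 Q \<ge> 1 \<Longrightarrow> R None None (Some F0)" "axis1 Q = 2 \<Longrightarrow> R (Some F2) None None"
    "axis2 Q = 2 \<Longrightarrow> R None (Some F2) None" "axis3 Q = 2 \<Longrightarrow> R None None (Some F2)"
proof -
  have *: "\<exists>i. (line_count (\<lambda>a. L (Some a)) \<ge> 1 \<longrightarrow> L (Some i)) \<and>
      (line_count (\<lambda>a. L (Some a)) = 2 \<longrightarrow> L (Some (nx (nx i))))" if L: "indep_line L" for L
  proof -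
    have "line_count (\<lambda>a. L (Some a)) \<le> 2"
      using line_count_le[OF L] by linarith
    then consider "line_count (\<lambda>a. L (Some a)) = 0" | "line_count (\<lambda>a. L (Some a)) = 1" | "line_count (\<lambda>a. L (Some a)) = 2"
      by linarith
    then show ?thesis
    proof cases
      case 2
      then obtain a where "L (Some a)" by (rule line_count_1_obtain)
      then show ?thesis using 2 by auto
    next
      case 3
      then obtain a where "L (Some a)" "L (Some (nx (nx a)))"
        by (rule line_count_2_obtain[OF L])
      then show ?thesis by blast
    qed simp
  qed
  have L: "indep_line (\<lambda>x. Q x None None)" "indep_line (\<lambda>y. Q None y None)" "indep_line (\<lambda>z. Q None None z)"
    using assms by (auto simp: indep_cube_def)
  from *[OF L(1)] *[OF L(2)] *[OF L(3)] obtain i j k where ijk: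
    "axis1 Q \<ge> 1 \<Longrightarrow> Q (Some i) None None" "axis2 Q \<ge> 1 \<Longrightarrow> Q None (Some j) None"
    "axis3 Q \<ge> 1 \<Longrightarrow> Q None None (Some k)" "axis1 Q = 2 \<Longrightarrow> Q (Some (nx (nx i))) None None"
    "axis2 Q = 2 \<Longrightarrow> Q None (Some (nx (nx j))) None" "axis3 Q = 2 \<Longrightarrow> Q None None (Some (nx (nx k)))"
    unfolding axis1_def axis2_def axis3_def by blast
  show thesis
    by (rule that[of "shift_cube i j k Q"]) (use assms ijk in simp_all)
qed

lemma tight_direction1_222:
  assumes "indep_cube Q" "axis1 Q = 2" "axis2 Q = 2" "axis3 Q = 2"
    "2 * cube_count Q + 3 * (face2 Q + face3 Q) + 2 * axis1 Q = 110"
  shows False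
proof -
  obtain R where R: "indep_cube R" "cube_count R = cube_count Q" "face1 R = face1 Q"
    "face2 R = face2 Q" "face3 R = face3 Q" "axis1 R = axis1 Q" "axis2 R = axis2 Q" "axis3 R = axis3 Q"
    and hubs: "R (Some F0) None None" "R None (Some F0) None" "R None None (Some F0)"
     "R (Some F2) None None" "R None (Some F2) None" "R None None (Some F2)"
    using cube_hub_obtain[OF assms(1)] assms(2-4) by (metis one_le_numeral)
  have "\<forall>x. tight_plane (R (Some x)) (line_count (\<lambda>z. R (Some x) None (Some z)) = 2)"
    using direction1_tight[OF R(1)] assms(5) unfolding R by blast
  from no_tight_222[OF R(1) this hubs] show False .
qed

lemma tight_direction1_122:
  assumes "indep_cube Q" "axis1 Q = 1" "axis2 Q = 2" "axis3 Q = 2"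
    "2 * cube_count Q + 3 * (face2 Q + face3 Q) + 2 * axis1 Q = 110"
  shows False
proof -
  obtain R where R: "indep_cube R" "cube_count R = cube_count Q" "face1 R = face1 Q"
    "face2 R = face2 Q" "face3 R = face3 Q" "axis1 R = axis1 Q" "axis2 R = axis2 Q" "axis3 R = axis3 Q"
    and hubs: "R (Some F0) None None" "R None (Some F0) None" "R None None (Some F0)"
     "R None (Some F2) None" "R None None (Some F2)"
    using cube_hub_obtain[OF assms(1)] assms(2-4) by (metis one_le_numeral order_refl)
  have 1: "\<forall>x. tight_plane (R (Some x)) (line_count (\<lambda>z. R (Some x) None (Some z)) = 2)"
    using direction1_tight[OF R(1)] assms(5) unfolding R by blast
  have "single (\<lambda>x. R (Some x) None None)"
    using line_count_eq_1[of "\<lambda>x. R x None None"] R(1,6) assms(2)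
    unfolding axis1_def by (simp add: indep_cube_def)
  then have 2: "\<not> R (Some F2) None None" "\<not> R (Some F3) None None"
    using hubs(1) by (auto simp: single_def all_five)
  show False using no_tight_122[OF R(1) 1 hubs 2] .
qed

lemma tight_direction12_111:
  assumes "indep_cube Q" "axis1 Q = 1" "axis2 Q = 1" "axis3 Q = 1"
    "2 * cube_count Q + 3 * (face2 Q + face3 Q) + 2 * axis1 Q = 110"
    "2 * cube_count Q + 3 * (face1 Q + face3 Q) + 2 * axis2 Q = 110"
  shows False
proof -
  obtain R where R: "indep_cube R" "cube_count R = cube_count Q" "face1 R = face1 Q"
    "face2 R = face2 Q" "face3 R = face3 Q" "axis1 R = axis1 Q" "axis2 R = axis2 Q" "axis3 R = axis3 Q"
    and hubs: "R (Some F0) None None" "R None (Some F0) None" "R None None (Some F0)"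
    using cube_hub_obtain[OF assms(1)] assms(2-4) by (metis order_refl)
  have 1: "\<forall>x. tight_plane (R (Some x)) (line_count (\<lambda>z. R (Some x) None (Some z)) = 2)"
    using direction1_tight[OF R(1)] assms(5) unfolding R by blast
  have 2: "\<forall>y. tight_plane (\<lambda>x z. R x (Some y) z) (line_count (\<lambda>z. R None (Some y) (Some z)) = 2)"
    using direction2_tight[OF R(1)] assms(6) unfolding R by blast
  show False using no_tight_111[OF R(1) 1 2 hubs] .
qed

lemma tight_direction12_221:
  assumes "indep_cube Q" "axis1 Q = 2" "axis2 Q = 2" "axis3 Q = 1"
    "2 * cube_count Q + 3 * (face2 Q + face3 Q) + 2 * axis1 Q = 110"
    "2 * cube_count Q + 3 * (face1 Q + face3 Q) + 2 * axis2 Q = 110"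
  shows False
proof -
  obtain R where R: "indep_cube R" "cube_count R = cube_count Q" "face1 R = face1 Q"
    "face2 R = face2 Q" "face3 R = face3 Q" "axis1 R = axis1 Q" "axis2 R = axis2 Q" "axis3 R = axis3 Q"
    and hubs: "R (Some F0) None None" "R None (Some F0) None" "R None None (Some F0)"
      "R (Some F2) None None" "R None (Some F2) None"
    using cube_hub_obtain[OF assms(1)] assms(2-4) by (metis one_le_numeral order_refl)
  have 1: "\<forall>x. tight_plane (R (Some x)) (line_count (\<lambda>z. R (Some x) None (Some z)) = 2)"
    using direction1_tight[OF R(1)] assms(5) unfolding R by blast
  have 2: "\<forall>y. tight_plane (\<lambda>x z. R x (Some y) z) (line_count (\<lambda>z. R None (Some y) (Some z)) = 2)"
    using direction2_tight[OF R(1)] assms(6) unfolding R by blast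
  show False using no_tight_221[OF R(1) 1 2 hubs] .
qed

lemma face_bounds:
  assumes "indep_cube Q"
  shows "axis1 Q \<le> 2" "axis2 Q \<le> 2" "axis3 Q \<le> 2"
    "face1 Q + 2 * axis2 Q \<le> 10" "face1 Q + 2 * axis3 Q \<le> 10" "axis2 Q = 2 \<Longrightarrow> axis3 Q = 2 \<Longrightarrow> face1 Q \<le> 5"
    "face2 Q + 2 * axis1 Q \<le> 10" "face2 Q + 2 * axis3 Q \<le> 10" "axis1 Q = 2 \<Longrightarrow> axis3 Q = 2 \<Longrightarrow> face2 Q \<le> 5"
    "face3 Q + 2 * axis1 Q \<le> 10" "face3 Q + 2 * axis2 Q \<le> 10" "axis1 Q = 2 \<Longrightarrow> axis2 Q = 2 \<Longrightarrow> face3 Q \<le> 5"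
proof -
  note f = face1_bounds[OF assms]
  note g = face1_bounds[OF swap_indep(1)[OF assms]]
  note h = face1_bounds[OF swap_indep(1)[OF swap_indep(2)[OF assms]]]
  show "axis1 Q \<le> 2" "face1 Q + 2 * axis2 Q \<le> 10" "face1 Q + 2 * axis3 Q \<le> 10"
    "axis2 Q = 2 \<Longrightarrow> axis3 Q = 2 \<Longrightarrow> face1 Q \<le> 5"
    by (fact f)+
  show "axis2 Q \<le> 2" "face2 Q + 2 * axis1 Q \<le> 10" "face2 Q + 2 * axis3 Q \<le> 10"
    "axis1 Q = 2 \<Longrightarrow> axis3 Q = 2 \<Longrightarrow> face2 Q \<le> 5"
    using g by simp_all
  show "axis3 Q \<le> 2" "face3 Q + 2 * axis1 Q \<le> 10" "face3 Q + 2 * axis2 Q \<le> 10"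
    "axis1 Q = 2 \<Longrightarrow> axis2 Q = 2 \<Longrightarrow> face3 Q \<le> 5"
    using h by simp_all
qed

text \<open>Averaging the three direction bounds proves this up to the four tight configurations above.\<close>

lemma cycle_slice_bound_sorted:
  assumes Q: "indep_cube Q" and ord: "axis1 Q \<ge> axis2 Q" "axis2 Q \<ge> axis3 Q"
  shows "2 * cube_count Q + 2 * (face1 Q + face2 Q + face3 Q) + (axis1 Q + axis2 Q + axis3 Q) \<le> 110"
proof (rule ccontr)
  note S = swap_indep(1)[OF swap_indep(2)[OF Q]]
  note ex111 = tight_direction12_111[OF Q] and ex221 = tight_direction12_221[OF Q]
   and ex222 = tight_direction1_222[OF Q]
  \<comment> \<open>Direction 3 is the one with axis count 1; moved to the front it turns the counts
    2, 2, 1 into 1, 2, 2.\<close>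
  have ex122: "\<lbrakk>axis1 Q = 2; axis2 Q = 2; axis3 Q = 1;
      2 * cube_count Q + 3 * (face1 Q + face2 Q) + 2 * axis3 Q = 110\<rbrakk> \<Longrightarrow> False"
    using tight_direction1_122[OF S] by simp
  define n t1 t2 t3 u1 u2 u3 where defs: "n = cube_count Q" "t1 = face1 Q" "t2 = face2 Q" "t3 = face3 Q"
    "u1 = axis1 Q" "u2 = axis2 Q" "u3 = axis3 Q"
  note d = direction1_le[OF Q] direction2_le[OF Q] direction3_le[OF Q]
  note all = ord face_bounds(1)[OF Q] ex111 ex221 ex222 ex122 d
  note all' = all[folded defs, unfolded distrib_left]
  assume "\<not> ?thesis"
  then have neg: "2 * n + 2 * t1 + 2 * t2 + 2 * t3 + u1 + u2 + u3 \<ge> 111"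
    unfolding defs by simp
  have "u1 \<le> 2" "u2 \<le> u1" "u3 \<le> u2"
    using all'(1-3) by auto
  moreover from this have "u1 = 0 \<or> u1 = 1 \<or> u1 = 2" "u2 = 0 \<or> u2 = 1 \<or> u2 = 2" "u3 = 0 \<or> u3 = 1 \<or> u3 = 2"
    by linarith+
  ultimately have "u1 + u2 + u3 \<le> 2 \<or> u1 = 1 \<and> u2 = 1 \<and> u3 = 1 \<or> u1 = 2 \<and> u2 = 1 \<and> u3 = 0
    \<or> u1 = 2 \<and> u2 = 1 \<and> u3 = 1 \<or> u1 = 2 \<and> u2 = 2 \<and> u3 = 0 \<or> u1 = 2 \<and> u2 = 2 \<and> u3 = 1
    \<or> u1 = 2 \<and> u2 = 2 \<and> u3 = 2"
    by (elim disjE; simp)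
  then consider "u1 + u2 + u3 \<le> 2" | "u1 = 1" "u2 = 1" "u3 = 1" | "u1 = 2" "u2 = 1" "u3 = 0"
    | "u1 = 2" "u2 = 1" "u3 = 1" | "u1 = 2" "u2 = 2" "u3 = 0" | "u1 = 2" "u2 = 2" "u3 = 1"
    | "u1 = 2" "u2 = 2" "u3 = 2"
    by blast
  then show False
  proof cases
    \<comment> \<open>A third of the sum of the direction bounds shows that the left side is at most
      110 + (u1 + u2 + u3)/3 < 111.\<close>
    case 1
    then show False using neg all'(8-10) by linarith
  next
    case 2
    \<comment> \<open>By \<open>neg\<close>, n + t1 + t2 + t3 is at least 54; the sum of the
      direction bounds makes it at most 54, so every direction is tight.\<close>
    have "2 * n + (3 * t2 + 3 * t3) + 2 * u1 = 110" "2 * n + (3 * t1 + 3 * t3) + 2 * u2 = 110"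
      using 2 neg all'(8-10) by linarith+
    then show False using all'(4) 2 by blast
  next
    case 3
    have "2 * n + (3 * t2 + 3 * t3) + 2 * u1 = 110" "2 * n + (3 * t1 + 3 * t3) + 2 * u2 = 110"
      using 3 neg all'(8-10) by linarith+
    \<comment> \<open>Subtracting the equalities leaves 2(u1 - u2) = 2, which is not a multiple of
      3.\<close>
    then have "3 * t1 = 3 * t2 + 2" using 3 by linarith
    then show False by presburger
  next
    case 4
    \<comment> \<open>Parity: 2(n + t1 + t2 + t3) is at least 107. Then the direction bounds would
      sum to at least 6 * 54 + 8 > 330.\<close>
    then have "n + t1 + t2 + t3 \<ge> 54" using neg by linarith
    then show False using 4 all'(8-10) by linarith
  next
    case 5
    then have "n + t1 + t2 + t3 \<ge> 54" using neg by linarith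
    then show False using 5 all'(8-10) by linarith
  next
    case 6
    have "n + t1 + t2 + t3 = 53"
      using 6 neg all'(8-10) by linarith
    \<comment> \<open>The three direction bounds have total slack 2, and the slacks in directions 1
      and 2 differ by 3(t1 - t2).\<close>
    moreover have "t1 = t2"
      using calculation 6 all'(8-10) by linarith
    moreover have "t1 = t3 \<or> t1 = Suc t3"
      using calculation 6 all'(8-10) by linarith
    \<comment> \<open>For t1 = t3 directions 1 and 2 are tight, otherwise direction 3 is.\<close>
    ultimately have "2 * n + (3 * t2 + 3 * t3) + 2 * u1 = 110 \<and> 2 * n + (3 * t1 + 3 * t3) + 2 * u2 = 110
       \<or> 2 * n + (3 * t1 + 3 * t2) + 2 * u3 = 110"
      using 6 by linarith
    then show False using all'(5) all'(7) 6 by blast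
  next
    case 7
    then have "n + t1 + t2 + t3 \<ge> 53" using neg by linarith
    then have "2 * n + (3 * t2 + 3 * t3) + 2 * u1 = 110"
      using 7 all'(8-10) by linarith
    then show False using all'(6) 7 by blast
  qed
qed

lemma cycle_slice_bound:
  assumes Q: "indep_cube Q"
  shows "2 * cube_count Q + 2 * (face1 Q + face2 Q + face3 Q) + (axis1 Q + axis2 Q + axis3 Q) \<le> 110"
proof -
  have *: "2 * cube_count Q + 2 * (face1 Q + face2 Q + face3 Q) + (axis1 Q + axis2 Q + axis3 Q) \<le> 110"
    if "axis1 Q \<ge> axis2 Q" "axis1 Q \<ge> axis3 Q" "indep_cube Q" for Q
    using cycle_slice_bound_sorted[of Q] cycle_slice_bound_sorted[of "swap23 Q"] that
    by (cases "axis2 Q \<ge> axis3 Q") (simp_all add: ac_simps)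
  consider "axis1 Q \<ge> axis2 Q" "axis1 Q \<ge> axis3 Q" | "axis2 Q \<ge> axis1 Q" "axis2 Q \<ge> axis3 Q"
    | "axis3 Q \<ge> axis1 Q" "axis3 Q \<ge> axis2 Q" by linarith
  then show ?thesis
    using *[of Q] *[of "swap12 Q"] *[of "swap12 (swap23 Q)"] Q
    by cases (simp_all add: ac_simps)
qed

section \<open>Slices with a hub coordinate\<close>

lemma five_nx_cases: "a = i \<or> a = nx i \<or> a = nx (nx i) \<or> a = nx (nx (nx i)) \<or> a = nx (nx (nx (nx i)))"
  by (cases i; cases a) simp_all

lemma sum_five_eq_9:
  fixes f :: "five \<Rightarrow> nat"
  assumes "\<And>a. f a \<le> 2" "sum f UNIV = 9"
  obtains i where "f i = 1" "\<And>a. a \<noteq> i \<Longrightarrow> f a = 2"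
proof -
  have "\<exists>i. f i \<noteq> 2"
  proof (rule ccontr)
    assume "\<not> ?thesis"
    then show False using assms(2) by (simp add: UNIV_five)
  qed
  then obtain i where i: "f i \<noteq> 2" by blast
  note b = assms(1)[of i] assms(1)[of "nx i"] assms(1)[of "nx (nx i)"] assms(1)[of "nx (nx (nx i))"]
    assms(1)[of "nx (nx (nx (nx i)))"] assms(2)[unfolded sum_five_rotate[of f i]]
  have "f i = 1" "f (nx i) = 2" "f (nx (nx i)) = 2" "f (nx (nx (nx i))) = 2" "f (nx (nx (nx (nx i)))) = 2"
    using i b by linarith+
  then show thesis
    using that[of i] five_nx_cases[of _ i] by metis
qed

lemma sum_five_eq_10:
  fixes f :: "five \<Rightarrow> nat"
  assumes "\<And>a. f a \<le> 2" "sum f UNIV = 10"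
  shows "f a = 2"
  using assms(1)[of a] assms(1)[of "nx a"] assms(1)[of "nx (nx a)"] assms(1)[of "nx (nx (nx a))"]
    assms(1)[of "nx (nx (nx (nx a)))"] assms(2)[unfolded sum_five_rotate[of f a]]
  by linarith

lemma row_count_le_2: "indep_plane P \<Longrightarrow> line_count (\<lambda>b. P (Some a) (Some b)) \<le> 2"
  using row_count_le[of P a] by linarith

lemma col_count_le_2: "indep_plane P \<Longrightarrow> line_count (\<lambda>a. P (Some a) (Some b)) \<le> 2"
  using row_count_le_2[OF indep_plane_transpose] .

lemma plane_count_cols: "plane_count P = (\<Sum>b\<in>UNIV. line_count (\<lambda>a. P (Some a) (Some b)))"
  unfolding plane_count_def line_count_def by (rule sum.swap)

lemma nine_obtain:
  assumes P: "indep_plane P" and "plane_count P = 9"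
  obtains i j where "nine P (\<lambda>a. a = i) (\<lambda>b. b = j)"
    "line_count (\<lambda>b. P (Some i) (Some b)) = 1" "line_count (\<lambda>a. P (Some a) (Some j)) = 1"
    "\<And>a. a \<noteq> i \<Longrightarrow> line_count (\<lambda>b. P (Some a) (Some b)) = 2"
proof -
  obtain i where i: "line_count (\<lambda>b. P (Some i) (Some b)) = 1"
      "\<And>a. a \<noteq> i \<Longrightarrow> line_count (\<lambda>b. P (Some a) (Some b)) = 2"
    using sum_five_eq_9[of "\<lambda>a. line_count (\<lambda>b. P (Some a) (Some b))"] row_count_le_2[OF P] assms(2)
    unfolding plane_count_def by blast
  obtain j where j: "line_count (\<lambda>a. P (Some a) (Some j)) = 1"
      "\<And>b. b \<noteq> j \<Longrightarrow> line_count (\<lambda>a. P (Some a) (Some b)) = 2"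
    using sum_five_eq_9[of "\<lambda>b. line_count (\<lambda>a. P (Some a) (Some b))"] col_count_le_2[OF P] assms(2)
    unfolding plane_count_cols by blast
  have one: "at_most_one (\<lambda>a. a = i)" for i
    by (cases i) (simp_all add: at_most_one_def all_five)
  have "line_count (\<lambda>b. P (Some a) (Some b)) > 0" "line_count (\<lambda>b. P (Some b) (Some a)) > 0" for a
    using i j by (metis zero_less_numeral zero_less_one)+
  then have ne: "nonempty (\<lambda>b. P (Some a) (Some b))" "nonempty (\<lambda>b. P (Some b) (Some a))" for a
    using line_count_pos[OF indep_plane_row[OF P]] line_count_pos[OF indep_plane_col[OF P]] by blast+
  have "a = i \<or> full (\<lambda>b. P (Some a) (Some b))" "a = j \<or> full (\<lambda>b. P (Some b) (Some a))" for a
    using i(2) j(2) line_count_eq_2[OF indep_plane_row[OF P]] line_count_eq_2[OF indep_plane_col[OF P]] by blast+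
  then have "nine P (\<lambda>a. a = i) (\<lambda>b. b = j)"
    using one ne unfolding nine_def by blast
  then show thesis using that i j(1) by blast
qed

lemma nine_at:
  assumes "indep_plane P" "plane_count P = 9" "line_count (\<lambda>b. P (Some i) (Some b)) = 1"
    "line_count (\<lambda>a. P (Some a) (Some j)) = 1"
  shows "nine P (\<lambda>a. a = i) (\<lambda>b. b = j)"
proof -
  obtain i' j' where *: "nine P (\<lambda>a. a = i') (\<lambda>b. b = j')"
      "\<And>a. a \<noteq> i' \<Longrightarrow> line_count (\<lambda>b. P (Some a) (Some b)) = 2"
    using nine_obtain[OF assms(1,2)] by metis
  \<comment> \<open>\<open>nine_obtain\<close> gives uniqueness of the exceptional row only; the
    transposed plane gives it for the column.\<close>
  obtain j'' i'' where **: "nine (\<lambda>x y. P y x) (\<lambda>a. a = j'') (\<lambda>b. b = i'')"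
      "\<And>b. b \<noteq> j'' \<Longrightarrow> line_count (\<lambda>a. P (Some a) (Some b)) = 2"
    using nine_obtain[OF indep_plane_transpose[OF assms(1)]] assms(2) plane_count_transpose[of P] by metis
  have "i' = i" "j'' = j"
    using *(2)[of i] **(2)[of j] assms(3,4) by (metis one_eq_numeral_iff num.distinct(1))+
  then show ?thesis
    using *(1) **(1) unfolding nine_def by blast
qed

lemma full_faces:
  assumes "indep_cube Q"
  shows "face1 Q + 2 * axis2 Q = 10 \<Longrightarrow> full_rows (Q None)"
    "face1 Q + 2 * axis3 Q = 10 \<Longrightarrow> full_cols (Q None)"
    "face2 Q + 2 * axis1 Q = 10 \<Longrightarrow> full_rows (\<lambda>x z. Q x None z)"
    "face2 Q + 2 * axis3 Q = 10 \<Longrightarrow> full_cols (\<lambda>x z. Q x None z)"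
    "face3 Q + 2 * axis1 Q = 10 \<Longrightarrow> full_rows (\<lambda>x y. Q x y None)"
    "face3 Q + 2 * axis2 Q = 10 \<Longrightarrow> full_cols (\<lambda>x y. Q x y None)"
  unfolding count_defs
  by (rule full_rows_if_count_eq full_cols_if_count_eq; use indep_cube_planes[OF assms] in simp)+

lemma no_axis_hubs:
  "axis1 Q = 0 \<Longrightarrow> \<forall>a. \<not> Q (Some a) None None" "axis2 Q = 0 \<Longrightarrow> \<forall>a. \<not> Q None (Some a) None"
  "axis3 Q = 0 \<Longrightarrow> \<forall>a. \<not> Q None None (Some a)"
  by (simp_all add: count_defs line_count_def sum_five all_five)

lemma face23_sum:
  "face2 Q = (\<Sum>x\<in>UNIV. line_count (\<lambda>z. Q (Some x) None (Some z)))"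
  "face3 Q = (\<Sum>x\<in>UNIV. line_count (\<lambda>y. Q (Some x) (Some y) None))"
  by (simp_all add: count_defs plane_count_def)

lemma axis_counts_le_2:
  assumes "indep_cube Q"
  shows "line_count (\<lambda>z. Q (Some x) None (Some z)) \<le> 2" "line_count (\<lambda>y. Q (Some x) (Some y) None) \<le> 2"
  using hub_counts_le[OF indep_cube_planes(1)[OF assms]] .

lemma face2_eq_10: "indep_cube Q \<Longrightarrow> face2 Q = 10 \<Longrightarrow> line_count (\<lambda>z. Q (Some x) None (Some z)) = 2"
  and face3_eq_10: "indep_cube Q \<Longrightarrow> face3 Q = 10 \<Longrightarrow> line_count (\<lambda>y. Q (Some x) (Some y) None) = 2"
  unfolding face23_sum
  by (rule sum_five_eq_10[of _ x]; simp add: axis_counts_le_2)+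

lemma shift_F134 [simp]: "shift i F1 = nx i" "shift i F3 = nx (nx (nx i))" "shift i F4 = nx (nx (nx (nx i)))"
  by (cases i; simp)+

lemma line_count_shift: "line_count (\<lambda>a. L (shift i a)) = line_count L"
  unfolding line_count_def by (rule sum_shift[of "\<lambda>a. of_bool (L a)"])

lemma shift_cube_line_counts:
  "line_count (\<lambda>z. shift_cube i j k Q (Some F0) None (Some z)) = line_count (\<lambda>z. Q (Some i) None (Some z))"
  "line_count (\<lambda>y. shift_cube i j k Q (Some F0) (Some y) None) = line_count (\<lambda>y. Q (Some i) (Some y) None)"
  "line_count (\<lambda>z. shift_cube i j k Q None (Some F0) (Some z)) = line_count (\<lambda>z. Q None (Some j) (Some z))"
  "line_count (\<lambda>x. shift_cube i j k Q (Some x) (Some F0) None) = line_count (\<lambda>x. Q (Some x) (Some j) None)"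
  "line_count (\<lambda>y. shift_cube i j k Q None (Some y) (Some F0)) = line_count (\<lambda>y. Q None (Some y) (Some k))"
  "line_count (\<lambda>x. shift_cube i j k Q (Some x) None (Some F0)) = line_count (\<lambda>x. Q (Some x) None (Some k))"
  unfolding shift_cube_def option.map shift_F0
  by (rule line_count_shift[of "\<lambda>z. Q _ _ (Some z)"] line_count_shift[of "\<lambda>y. Q _ (Some y) _"]
    line_count_shift[of "\<lambda>x. Q (Some x) _ _"])+

lemma plane_count_shift_cube: "plane_count (shift_cube i F0 F0 Q (Some x)) = plane_count (Q (Some (shift i x)))"
proof -
  have "map_option (shift F0) = id"
    by (rule ext, rename_tac y, case_tac y) simp_all
  then show ?thesis by (simp add: shift_cube_def)
qed

section \<open>Cube counts for nearly maximal faces\<close>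

lemma card_UNIV_five: "card (UNIV :: five set) = 5"
  by (simp add: UNIV_five)

text \<open>At most two values are below 5. If two are, both equal 4: when adjacent they leave three
  consecutive fives, the second pattern. Two nonadjacent ones, or fewer than two, leave fives at
  some \<open>i\<close>, \<open>i + 1\<close> and \<open>i + 3\<close>.\<close>

lemma deficit_two:
  fixes f :: "five \<Rightarrow> nat"
  assumes f5: "\<And>x. f x \<le> 5" and sum: "sum f UNIV \<ge> 23"
  shows "\<exists>i. f i \<ge> 5 \<and> f (nx i) \<ge> 5 \<and> (f (nx (nx (nx i))) \<ge> 5 \<or>
      f (nx (nx i)) \<ge> 5 \<and> f (nx (nx (nx i))) \<ge> 4 \<and> f (nx (nx (nx (nx i)))) \<ge> 4)"
    (is "\<exists>i. ?A i")
proof (rule ccontr)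
  assume neg: "\<not> ?thesis"
  define b where "b x \<longleftrightarrow> f x \<ge> 5" for x
  have two: "\<not> (\<not> b x \<and> \<not> b y \<and> \<not> b z)" if "x \<noteq> y" "y \<noteq> z" "x \<noteq> z" for x y z
  proof
    assume "\<not> b x \<and> \<not> b y \<and> \<not> b z"
    then have "f x \<le> 4" "f y \<le> 4" "f z \<le> 4" unfolding b_def by linarith+
    moreover have "sum f UNIV = sum f {x, y, z} + sum f (UNIV - {x, y, z})"
      using sum.subset_diff[of "{x, y, z}" UNIV f] by simp
    moreover have "sum f (UNIV - {x, y, z}) \<le> 5 * card (UNIV - {x, y, z})"
      using sum_bounded_above[of "UNIV - {x, y, z}" f 5] f5 by simp
    moreover have "card (UNIV - {x, y, z}) = 2"
      using that by (subst card_Diff_subset) (simp_all add: card_UNIV_five)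
    ultimately show False using sum that by simp
  qed
  have four: "f y \<ge> 4" if "\<not> b x" "x \<noteq> y" for x y
  proof -
    have "f x \<le> 4" using that(1) unfolding b_def by linarith
    moreover have "sum f UNIV = sum f {x, y} + sum f (UNIV - {x, y})"
      using sum.subset_diff[of "{x, y}" UNIV f] by simp
    moreover have "sum f (UNIV - {x, y}) \<le> 5 * card (UNIV - {x, y})"
      using sum_bounded_above[of "UNIV - {x, y}" f 5] f5 by simp
    moreover have "card (UNIV - {x, y}) = 3"
      using that by (subst card_Diff_subset) (simp_all add: card_UNIV_five)
    ultimately show ?thesis using sum that by simp
  qed
  have four': "f (nx (nx (nx i))) \<ge> 4 \<and> f (nx (nx (nx (nx i)))) \<ge> 4" if "\<not> b (nx (nx (nx i)))" "\<not> b (nx (nx (nx (nx i))))" for i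
    using four that by (cases i) (metis five.distinct nx.simps)+
  have "\<not> (b i \<and> b (nx i) \<and> b (nx (nx (nx i))))"
      "\<not> (b i \<and> b (nx i) \<and> b (nx (nx i)) \<and> \<not> b (nx (nx (nx i))) \<and> \<not> b (nx (nx (nx (nx i)))))" for i
    using neg four'[of i] unfolding b_def by blast+
  note n = this[of F0] this[of F1] this[of F2] this[of F3] this[of F4]
  show False
    using n two[of F0 F1 F2] two[of F0 F1 F3] two[of F0 F1 F4] two[of F0 F2 F3] two[of F0 F2 F4] two[of F0 F3 F4]
      two[of F1 F2 F3] two[of F1 F2 F4] two[of F1 F3 F4] two[of F2 F3 F4]
      five.distinct
    unfolding nx.simps by sat
qed

text \<open>Ten points in faces 2 and 3 force r = c = 2, hence p \<le> 5, in each plane at a cycle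
  vertex. A total of 23 leaves a defect of at most two, which \<open>deficit_two\<close> reduces to
  two refuted patterns.\<close>

lemma cube_count_10_10_10:
  assumes Q: "indep_cube Q" and faces: "face1 Q = 10" "face2 Q = 10" "face3 Q = 10"
    and axes: "axis1 Q = 0" "axis2 Q = 0" "axis3 Q = 0"
  shows "cube_count Q \<le> 22"
proof (rule ccontr)
  define f where "f x = plane_count (Q (Some x))" for x
  have f5: "f x \<le> 5" for x
    unfolding f_def by (rule plane_count_22_le[OF indep_cube_planes(1)[OF Q] face2_eq_10[OF Q faces(2)] face3_eq_10[OF Q faces(3)]])
  assume "\<not> ?thesis"
  then have "sum f UNIV \<ge> 23" unfolding f_def cube_count_def by linarith
  then have "\<exists>i. f i \<ge> 5 \<and> f (nx i) \<ge> 5 \<and> (f (nx (nx (nx i))) \<ge> 5 \<or>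
      f (nx (nx i)) \<ge> 5 \<and> f (nx (nx (nx i))) \<ge> 4 \<and> f (nx (nx (nx (nx i)))) \<ge> 4)"
    by (rule deficit_two[OF f5])
  then obtain i where i: "f i \<ge> 5" "f (nx i) \<ge> 5"
    "f (nx (nx (nx i))) \<ge> 5 \<or> f (nx (nx i)) \<ge> 5 \<and> f (nx (nx (nx i))) \<ge> 4 \<and> f (nx (nx (nx (nx i)))) \<ge> 4"
    by blast
  define R where "R = shift_cube i F0 F0 Q"
  have R: "indep_cube R" "face1 R = 10" "face2 R = 10" "face3 R = 10" "axis1 R = 0" "axis2 R = 0" "axis3 R = 0"
    using assms by (simp_all add: R_def)
  have p: "plane_count (R (Some x)) = f (shift i x)" for x
    unfolding R_def f_def by (rule plane_count_shift_cube)
  note full = full_faces[OF R(1)]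
  have faces: "full_rows (R None)" "full_cols (R None)"
    "full_rows (\<lambda>x z. R x None z)" "full_cols (\<lambda>x z. R x None z)"
    "full_rows (\<lambda>x y. R x y None)" "full_cols (\<lambda>x y. R x y None)"
    by (rule full; simp add: R(2-))+
  note faces = faces no_axis_hubs(2)[OF R(6)] no_axis_hubs(3)[OF R(7)] no_axis_hubs(1)[OF R(5)]
  note planes = indep_cube_planes(1)[OF R(1)] face2_eq_10[OF R(1,3)] face3_eq_10[OF R(1,4)]
  have tight: "tight22 (R (Some x))" if "f (shift i x) \<ge> 5" for x
    using tight22I[OF planes] that unfolding p .
  have near: "near22 (R (Some x))" if "f (shift i x) \<ge> 4" for x
    using near22I[OF planes] that unfolding p .
  have t: "tight22 (R (Some F0))" "tight22 (R (Some F1))"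
    by (rule tight; simp add: i)+
  from i(3) show False
  proof (elim disjE conjE)
    assume "f (nx (nx (nx i))) \<ge> 5"
    then have "tight22 (R (Some F3))" by (intro tight) simp
    from no_full_013[OF R(1) faces t this] show False .
  next
    assume *: "f (nx (nx i)) \<ge> 5" "f (nx (nx (nx i))) \<ge> 4" "f (nx (nx (nx (nx i)))) \<ge> 4"
    have "tight22 (R (Some F2))" "near22 (R (Some F3))" "near22 (R (Some F4))"
      using * by (auto intro: tight near)
    from no_full_near[OF R(1) faces t this] show False .
  qed
qed

text \<open>Again p \<le> 5 in all five planes, so a total of 25 makes all of them tight. The
  exceptional lines of the first face are rotated to \<open>F0\<close>.\<close>

lemma cube_count_9_10_10:
  assumes Q: "indep_cube Q" and faces: "face1 Q = 9" "face2 Q = 10" "face3 Q = 10"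
    and axes: "axis1 Q = 0" "axis2 Q = 0" "axis3 Q = 0"
  shows "cube_count Q \<le> 24"
proof (rule ccontr)
  assume "\<not> ?thesis"
  then have N: "cube_count Q \<ge> 25" by linarith
  obtain i j where ij: "line_count (\<lambda>b. Q None (Some i) (Some b)) = 1" "line_count (\<lambda>a. Q None (Some a) (Some j)) = 1"
    using nine_obtain[OF indep_cube_planes(1)[OF Q]] faces(1) unfolding face1_def by metis
  define R where "R = shift_cube F0 i j Q"
  have R: "indep_cube R" "face1 R = 9" "face2 R = 10" "face3 R = 10" "axis1 R = 0" "axis2 R = 0" "axis3 R = 0"
      "cube_count R \<ge> 25"
    using assms N by (simp_all add: R_def)
  have "line_count (\<lambda>b. R None (Some F0) (Some b)) = 1" "line_count (\<lambda>a. R None (Some a) (Some F0)) = 1"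
    unfolding R_def shift_cube_line_counts by (fact ij)+
  then have nine: "nine (R None) (\<lambda>a. a = F0) (\<lambda>b. b = F0)"
    using nine_at[OF indep_cube_planes(1)[OF R(1)]] R(2) unfolding face1_def by blast
  note planes = indep_cube_planes(1)[OF R(1)] face2_eq_10[OF R(1,3)] face3_eq_10[OF R(1,4)]
  have "plane_count (R (Some x)) \<ge> 5" for x
    using plane_count_22_le[OF planes, of x] plane_count_22_le[OF planes, of "nx x"] plane_count_22_le[OF planes, of "nx (nx x)"]
      plane_count_22_le[OF planes, of "nx (nx (nx x))"] plane_count_22_le[OF planes, of "nx (nx (nx (nx x)))"]
      R(8)[unfolded cube_count_def sum_five_rotate[of _ x]]
    by linarith
  then have tight: "\<forall>x. tight22 (R (Some x))"
    using tight22I[OF planes] by blast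
  have faces: "full_rows (\<lambda>x z. R x None z)" "full_cols (\<lambda>x z. R x None z)"
    "full_rows (\<lambda>x y. R x y None)" "full_cols (\<lambda>x y. R x y None)"
    by (rule full_faces[OF R(1)]; simp add: R(2-))+
  show False
    by (rule no_nine_10_10[OF R(1) nine faces]) (use no_axis_hubs R(5-7) tight in blast)+
qed

lemma not_line_count_2_if_single:
  assumes "indep_line L" "single (\<lambda>a. L (Some a))"
  shows "line_count (\<lambda>a. L (Some a)) \<noteq> 2"
  using line_count_2_obtain[OF assms(1)] assms(2) unfolding single_def by blast

text \<open>Since 2 * 28 + 3 * 18 = 110, a count of 28 makes direction 1 tight.\<close>

lemma cube_count_9_9_9:
  assumes Q: "indep_cube Q" and faces: "face1 Q = 9" "face2 Q = 9" "face3 Q = 9"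
    and axes: "axis1 Q = 0" "axis2 Q = 0" "axis3 Q = 0"
  shows "cube_count Q \<le> 27"
proof (rule ccontr)
  assume "\<not> ?thesis"
  then have eq: "2 * cube_count Q + 3 * (face2 Q + face3 Q) + 2 * axis1 Q = 110"
    using direction1_le[OF Q] by (simp add: faces axes)
  note tp = direction1_tight[OF Q eq]
  obtain i k where ik: "line_count (\<lambda>z. Q (Some i) None (Some z)) = 1" "line_count (\<lambda>x. Q (Some x) None (Some k)) = 1"
      "\<And>x. x \<noteq> i \<Longrightarrow> line_count (\<lambda>z. Q (Some x) None (Some z)) = 2"
    using nine_obtain[OF indep_cube_planes(2)[OF Q]] faces(2) unfolding face2_def by metis
  obtain i' j where ij: "line_count (\<lambda>y. Q (Some i') (Some y) None) = 1" "line_count (\<lambda>x. Q (Some x) (Some j) None) = 1"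
      "\<And>x. x \<noteq> i' \<Longrightarrow> line_count (\<lambda>y. Q (Some x) (Some y) None) = 2"
    using nine_obtain[OF indep_cube_planes(3)[OF Q]] faces(3) unfolding face3_def by metis
  have "tight11 (Q (Some i))"
    using tp[of i] ik(1) no_axis_hubs(1)[OF axes(1)] by (simp add: tight_plane_def)
  \<comment> \<open>The tight plane at \<open>i\<close> has r = 1, hence also c = 1. Only one plane
    has c different from 2, so the exceptional first coordinates of faces 2 and 3 agree.\<close>
  then have "i' = i"
    using not_line_count_2_if_single[OF indep_plane_col[OF indep_cube_planes(1)[OF Q]]] ij(3)[of i]
    unfolding tight11_def by blast
  define R where "R = shift_cube i j k Q"
  have R: "indep_cube R" "face1 R = 9" "face2 R = 9" "face3 R = 9" "axis1 R = 0" "axis2 R = 0" "axis3 R = 0"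
      "2 * cube_count R + 3 * (face2 R + face3 R) + 2 * axis1 R = 110"
    using assms eq by (simp_all add: R_def)
  note hubs = no_axis_hubs(2)[OF R(6)] no_axis_hubs(3)[OF R(7)] no_axis_hubs(1)[OF R(5)]
  have r: "line_count (\<lambda>z. R (Some F0) None (Some z)) = 1" "line_count (\<lambda>x. R (Some x) None (Some F0)) = 1"
    "line_count (\<lambda>y. R (Some F0) (Some y) None) = 1" "line_count (\<lambda>x. R (Some x) (Some F0) None) = 1"
    unfolding R_def shift_cube_line_counts
    using ik ij unfolding \<open>i' = i\<close> by blast+
  obtain e f where nine1: "nine (R None) e f"
    using nine_obtain[OF indep_cube_planes(1)[OF R(1)]] R(2) unfolding face1_def by metis
  have nine2: "nine (\<lambda>x z. R x None z) (\<lambda>a. a = F0) (\<lambda>a. a = F0)"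
    using nine_at[OF indep_cube_planes(2)[OF R(1)]] R(3) r unfolding face2_def by blast
  have nine3: "nine (\<lambda>x y. R x y None) (\<lambda>a. a = F0) (\<lambda>a. a = F0)"
    using nine_at[OF indep_cube_planes(3)[OF R(1)]] R(4) r unfolding face3_def by blast
  note tp = direction1_tight[OF R(1,8)]
  have t0: "tight11 (R (Some F0))"
    using tp[of F0] r(1) hubs(3) by (simp add: tight_plane_def)
  obtain i'' where i'': "\<And>x. x \<noteq> i'' \<Longrightarrow> line_count (\<lambda>z. R (Some x) None (Some z)) = 2"
    using nine_obtain[OF indep_cube_planes(2)[OF R(1)]] R(3) unfolding face2_def by metis
  then have "i'' = F0" using r(1) by (metis one_eq_numeral_iff num.distinct(1))
  then have t: "\<forall>x. x = F0 \<or> tight22 (R (Some x))"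
    using tp i'' hubs(3) unfolding tight_plane_def by blast
  show False
    by (rule no_nine_nine_nine[OF R(1) nine2 nine3 t0 t nine1 hubs])
qed

text \<open>The exceptional plane has c = 2 and so at most 10 - 4 = 6 points; the other four have r
  = c = 2 and at most 5. Hence 26 is the maximum and forces equality in every plane.\<close>

lemma planes_9_10:
  assumes Q: "indep_cube Q" and faces: "face2 Q = 9" "face3 Q = 10" and N: "cube_count Q \<ge> 26"
    and r: "line_count (\<lambda>z. Q (Some i) None (Some z)) = 1"
  shows "\<forall>x. x = i \<or> tight22 (Q (Some x))" "single (\<lambda>z. Q (Some i) None (Some z))" "full_rows (Q (Some i))"
proof -
  note P = indep_cube_planes(1)[OF Q]
  obtain i' where i': "\<And>x. x \<noteq> i' \<Longrightarrow> line_count (\<lambda>z. Q (Some x) None (Some z)) = 2"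
    using nine_obtain[OF indep_cube_planes(2)[OF Q]] faces(1) unfolding face2_def by metis
  then have "i' = i" using r by (metis one_eq_numeral_iff num.distinct(1))
  note i = i'[unfolded this]
  define p where "p x = plane_count (Q (Some x))" for x
  have pi: "p i \<le> 6" using plane_count_le_rows[OF P, of "Some i"] face3_eq_10[OF Q faces(2)] unfolding p_def by simp
  have p5: "p x \<le> 5" if "x \<noteq> i" for x
    using plane_count_22_le[OF P i[OF that] face3_eq_10[OF Q faces(2)]] unfolding p_def .
  have neq: "nx i \<noteq> i" "nx (nx i) \<noteq> i" "nx (nx (nx i)) \<noteq> i" "nx (nx (nx (nx i))) \<noteq> i"
    by (cases i; simp)+
  note b = p5[OF neq(1)] p5[OF neq(2)] p5[OF neq(3)] p5[OF neq(4)] N[unfolded cube_count_def sum_five_rotate[of _ i] p_def[symmetric]]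
  have "p i = 6" using pi b by linarith
  then show "full_rows (Q (Some i))"
    using full_rows_if_count_eq[OF P, of "Some i"] face3_eq_10[OF Q faces(2)] unfolding p_def by simp
  show "single (\<lambda>z. Q (Some i) None (Some z))"
    using line_count_eq_1[OF indep_plane_row[OF P] r] .
  have "p x \<ge> 5" if "x \<noteq> i" for x
    using five_nx_cases[of x i] that pi b by (elim disjE; hypsubst?; linarith)
  then show "\<forall>x. x = i \<or> tight22 (Q (Some x))"
    using tight22I[OF P i face3_eq_10[OF Q faces(2)]] unfolding p_def by blast
qed

text \<open>\<open>planes_9_10\<close> applies in direction 1 and, through \<open>swap12\<close>, in
  direction 2. The exceptional third coordinates \<open>k1\<close> and \<open>k2\<close> of the two
  faces may differ, so that coordinate is not rotated.\<close>

lemma cube_count_9_9_10: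
  assumes Q: "indep_cube Q" and faces: "face1 Q = 9" "face2 Q = 9" "face3 Q = 10"
    and axes: "axis1 Q = 0" "axis2 Q = 0" "axis3 Q = 0"
  shows "cube_count Q \<le> 25"
proof (rule ccontr)
  assume "\<not> ?thesis"
  then have N: "cube_count Q \<ge> 26" by linarith
  obtain j where jk: "line_count (\<lambda>z. Q None (Some j) (Some z)) = 1"
    using nine_obtain[OF indep_cube_planes(1)[OF Q]] faces(1) unfolding face1_def by metis
  obtain i where i: "line_count (\<lambda>z. Q (Some i) None (Some z)) = 1"
    using nine_obtain[OF indep_cube_planes(2)[OF Q]] faces(2) unfolding face2_def by metis
  define R where "R = shift_cube i j F0 Q"
  have R: "indep_cube R" "face1 R = 9" "face2 R = 9" "face3 R = 10" "axis1 R = 0" "axis2 R = 0" "axis3 R = 0"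
      "cube_count R \<ge> 26"
    using assms N by (simp_all add: R_def)
  note hubs = no_axis_hubs(2)[OF R(6)] no_axis_hubs(3)[OF R(7)] no_axis_hubs(1)[OF R(5)]
  have r: "line_count (\<lambda>z. R (Some F0) None (Some z)) = 1" "line_count (\<lambda>z. R None (Some F0) (Some z)) = 1"
    unfolding R_def shift_cube_line_counts by (fact i jk)+
  note A = planes_9_10[OF R(1,3,4,8) r(1)]
  have B: "\<forall>y. y = F0 \<or> tight22 (\<lambda>x z. R x (Some y) z)" "single (\<lambda>z. R None (Some F0) (Some z))"
    "full_rows (\<lambda>x z. R x (Some F0) z)"
    using planes_9_10[OF swap_indep(1)[OF R(1)], of F0] R(2-) r(2)
    unfolding swap12_counts unfolding swap12_def by blast+
  obtain k1 where "line_count (\<lambda>x. R None (Some x) (Some k1)) = 1"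
    using nine_obtain[OF indep_cube_planes(1)[OF R(1)]] R(2) unfolding face1_def by metis
  then have nine1: "nine (R None) (\<lambda>a. a = F0) (\<lambda>b. b = k1)"
    using nine_at[OF indep_cube_planes(1)[OF R(1)]] R(2) r(2) unfolding face1_def by blast
  obtain k2 where "line_count (\<lambda>x. R (Some x) None (Some k2)) = 1"
    using nine_obtain[OF indep_cube_planes(2)[OF R(1)]] R(3) unfolding face2_def by metis
  then have nine2: "nine (\<lambda>x z. R x None z) (\<lambda>a. a = F0) (\<lambda>b. b = k2)"
    using nine_at[OF indep_cube_planes(2)[OF R(1)]] R(3) r(1) unfolding face2_def by blast
  have faces: "full_rows (\<lambda>x y. R x y None)" "full_cols (\<lambda>x y. R x y None)"
    by (rule full_faces[OF R(1)]; simp add: R(2-))+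
  show False
    by (rule no_nine_nine_10[OF R(1) faces A(1) B(1) A(2) B(2) A(3) B(3) nine1 nine2 hubs])
qed

text \<open>The plane at \<open>F0\<close> contains an axis point, so it has r = c = 0 and at most
  ten cycle points. The eight points of faces 2 and 3 then force r = c = 2 in the other four planes,
  which have at most five each.\<close>

lemma cube_count_8_8_8:
  assumes Q: "indep_cube Q" and faces: "face1 Q = 8" "face2 Q = 8" "face3 Q = 8"
    and axes: "axis1 Q = 1" "axis2 Q = 1" "axis3 Q = 1"
  shows "cube_count Q \<le> 28"
proof (rule ccontr)
  assume "\<not> ?thesis"
  then have N: "cube_count Q \<ge> 29" by linarith
  obtain R where R: "indep_cube R" "cube_count R = cube_count Q" "face1 R = face1 Q"
    "face2 R = face2 Q" "face3 R = face3 Q" "axis1 R = axis1 Q" "axis2 R = axis2 Q" "axis3 R = axis3 Q"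
    and hubs: "R (Some F0) None None" "R None (Some F0) None" "R None None (Some F0)"
    using cube_hub_obtain[OF Q] axes by (metis order_refl)
  have faces': "full_rows (R None)" "full_cols (R None)" "full_rows (\<lambda>x z. R x None z)" "full_cols (\<lambda>x z. R x None z)"
    "full_rows (\<lambda>x y. R x y None)" "full_cols (\<lambda>x y. R x y None)"
    by (rule full_faces[OF R(1)]; simp add: R(2-) faces axes)+
  note P = indep_cube_planes(1)[OF R(1)]
  note z = hub_counts_eq_0[OF P hubs(1)]
  have rest: "f x = 2" if "f F0 = 0" "\<And>x. f x \<le> 2" "sum f UNIV = 8" "x \<noteq> F0" for f :: "five \<Rightarrow> nat" and x
    using that(1,3,4) that(2)[of F1] that(2)[of F2] that(2)[of F3] that(2)[of F4] unfolding sum_five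
    by (cases x; simp)
  have r: "line_count (\<lambda>z. R (Some x) None (Some z)) = 2" if "x \<noteq> F0" for x
    using rest[of "\<lambda>x. line_count (\<lambda>z. R (Some x) None (Some z))", OF z(1) axis_counts_le_2(1)[OF R(1)] _ that]
      R(4) faces(2) unfolding face23_sum by simp
  have c: "line_count (\<lambda>y. R (Some x) (Some y) None) = 2" if "x \<noteq> F0" for x
    using rest[of "\<lambda>x. line_count (\<lambda>y. R (Some x) (Some y) None)", OF z(2) axis_counts_le_2(2)[OF R(1)] _ that]
      R(5) faces(3) unfolding face23_sum by simp
  have p: "plane_count (R (Some F1)) \<le> 5" "plane_count (R (Some F2)) \<le> 5" "plane_count (R (Some F3)) \<le> 5" "plane_count (R (Some F4)) \<le> 5"
    by (rule plane_count_22_le[OF P r c]; simp)+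
  have tight: "tight22 (R (Some x))" if "x \<noteq> F0" "plane_count (R (Some x)) \<ge> 5" for x
    using tight22I[OF P r c] that by blast
  have p0: "plane_count (R (Some F0)) \<le> 10"
    using plane_count_le_rows[OF P, of "Some F0"] by linarith
  note b = p p0 N[folded R(2), unfolded cube_count_def sum_five]
  \<comment> \<open>The defect is at most one: with ten points at \<open>F0\<close> it spares
    \<open>F1\<close> or \<open>F4\<close>, with nine it spares both.\<close>
  consider "plane_count (R (Some F0)) = 10" "plane_count (R (Some F1)) \<ge> 5"
    | "plane_count (R (Some F0)) = 10" "plane_count (R (Some F4)) \<ge> 5"
    | "plane_count (R (Some F0)) = 9" "plane_count (R (Some F1)) \<ge> 5" "plane_count (R (Some F4)) \<ge> 5"
    using b by linarith
  then show False
  proof cases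
    case 1
    then have "tight00 (R (Some F0))"
      using full_rows_if_count_eq[OF P, of "Some F0"] full_cols_if_count_eq[OF P, of "Some F0"] z hubs(1)
      by (simp add: tight00_def)
    then show False using no_eight_1[OF R(1) faces' hubs] tight[of F1] 1 by simp
  next
    case 2
    then have "tight00 (R (Some F0))"
      using full_rows_if_count_eq[OF P, of "Some F0"] full_cols_if_count_eq[OF P, of "Some F0"] z hubs(1)
      by (simp add: tight00_def)
    then show False using no_eight_4[OF R(1) faces' hubs] tight[of F4] 2 by simp
  next
    case 3
    obtain e f where "nine (R (Some F0)) e f"
      using nine_obtain[OF P 3(1)] by metis
    then show False using no_eight_2[OF R(1) faces' hubs] tight[of F1] tight[of F4] 3 by simp
  qed
qed

text \<open>Subtracting three times a direction bound from the negated claim bounds the face missing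
  in that direction from below. Against \<open>face_bounds\<close> this excludes all axis counts but
  0, 0, 0 and 1, 1, 1, where the faces are almost determined and the cube counts above
  decide.\<close>

lemma hub_slice_bound_sorted:
  assumes Q: "indep_cube Q" and ord: "axis1 Q \<ge> axis2 Q" "axis2 Q \<ge> axis3 Q"
  shows "6 * cube_count Q + 9 * (face1 Q + face2 Q + face3 Q) + 8 * (axis1 Q + axis2 Q + axis3 Q)
    + 6 * of_bool (Q None None None) \<le> 413"
proof (rule ccontr)
  define n t1 t2 t3 u1 u2 u3 s where defs: "n = cube_count Q" "t1 = face1 Q" "t2 = face2 Q" "t3 = face3 Q"
    "u1 = axis1 Q" "u2 = axis2 Q" "u3 = axis3 Q" "s = (of_bool (Q None None None) :: nat)"
  assume "\<not> ?thesis"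
  then have neg: "6 * n + 9 * t1 + 9 * t2 + 9 * t3 + 8 * u1 + 8 * u2 + 8 * u3 + 6 * s \<ge> 414"
    unfolding defs by simp
  have d: "2 * n + 3 * t2 + 3 * t3 + 2 * u1 \<le> 110" "2 * n + 3 * t1 + 3 * t3 + 2 * u2 \<le> 110"
      "2 * n + 3 * t1 + 3 * t2 + 2 * u3 \<le> 110"
    using direction1_le[OF Q] direction2_le[OF Q] direction3_le[OF Q] unfolding defs by simp_all
  note fb = face_bounds[OF Q, folded defs]
  have "u1 = 0 \<or> u1 = 1 \<or> u1 = 2" "u2 = 0 \<or> u2 = 1 \<or> u2 = 2" "u3 = 0 \<or> u3 = 1 \<or> u3 = 2"
    using fb(1-3) by linarith+
  then have "u1 = 0 \<and> u2 = 0 \<and> u3 = 0 \<or> u1 = 1 \<and> u2 = 0 \<and> u3 = 0 \<or> u1 = 2 \<and> u2 = 0 \<and> u3 = 0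
    \<or> u1 = 1 \<and> u2 = 1 \<and> u3 = 0 \<or> u1 = 1 \<and> u2 = 1 \<and> u3 = 1 \<or> u1 = 2 \<and> u2 = 1 \<and> u3 = 0
    \<or> u1 = 2 \<and> u2 = 1 \<and> u3 = 1 \<or> u1 = 2 \<and> u2 = 2 \<and> u3 = 0 \<or> u1 = 2 \<and> u2 = 2 \<and> u3 = 1
    \<or> u1 = 2 \<and> u2 = 2 \<and> u3 = 2"
    using ord[folded defs] by (elim disjE; simp)
  then consider "u1 = 0" "u2 = 0" "u3 = 0" | "u1 = 1" "u2 = 0" "u3 = 0" | "u1 = 2" "u2 = 0" "u3 = 0"
    | "u1 = 1" "u2 = 1" "u3 = 0" | "u1 = 1" "u2 = 1" "u3 = 1" | "u1 = 2" "u2 = 1" "u3 = 0"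
    | "u1 = 2" "u2 = 1" "u3 = 1" | "u1 = 2" "u2 = 2" "u3 = 0" | "u1 = 2" "u2 = 2" "u3 = 1"
    | "u1 = 2" "u2 = 2" "u3 = 2"
    by (elim disjE conjE; blast)
  moreover have "s \<le> 1" unfolding defs by simp
  moreover have s0: "s = 0" if "u1 \<ge> 1"
  proof -
    have "indep_line (\<lambda>x. Q x None None)" using Q by (simp add: indep_cube_def)
    from line_count_le[OF this] have "u1 + 2 * s \<le> 2" unfolding defs axis1_def .
    then show ?thesis using that by linarith
  qed
  ultimately show False
  proof cases
    case 1
    then have "t1 \<ge> 9" "t2 \<ge> 9" "t3 \<ge> 9" "t1 \<le> 10" "t2 \<le> 10" "t3 \<le> 10"
      using neg d fb(4,7,10) \<open>s \<le> 1\<close> by linarith+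
    then have "t1 = 9 \<or> t1 = 10" "t2 = 9 \<or> t2 = 10" "t3 = 9 \<or> t3 = 10"
      by linarith+
    then consider "t1 = 10" "t2 = 10" "t3 = 10" | "t1 = 9" "t2 = 10" "t3 = 10"
      | "t1 = 10" "t2 = 9" "t3 = 10" | "t1 = 10" "t2 = 10" "t3 = 9" | "t1 = 9" "t2 = 9" "t3 = 9"
      | "t1 = 9" "t2 = 9" "t3 = 10" | "t1 = 9" "t2 = 10" "t3 = 9" | "t1 = 10" "t2 = 9" "t3 = 9"
      by (elim disjE conjE; blast)
    \<comment> \<open>407 is 413 less the weight 6 of a possible point with three hub
      coordinates.\<close>
    then have "6 * n + 9 * t1 + 9 * t2 + 9 * t3 \<le> 407"
    proof cases
      case 1 with cube_count_10_10_10[OF Q, folded defs] \<open>u1 = 0\<close> \<open>u2 = 0\<close> \<open>u3 = 0\<close>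
      show ?thesis by simp
    next
      case 2 with cube_count_9_10_10[OF Q, folded defs] \<open>u1 = 0\<close> \<open>u2 = 0\<close> \<open>u3 = 0\<close>
      show ?thesis by simp
    next
      case 3 with cube_count_9_10_10[OF swap_indep(1)[OF Q], unfolded swap12_counts, folded defs]
        \<open>u1 = 0\<close> \<open>u2 = 0\<close> \<open>u3 = 0\<close>
      show ?thesis by simp
    next
      case 4
      with cube_count_9_10_10[OF swap_indep(1)[OF swap_indep(2)[OF Q]],
          unfolded swap12_counts swap23_counts, folded defs]
        \<open>u1 = 0\<close> \<open>u2 = 0\<close> \<open>u3 = 0\<close>
      show ?thesis by simp
    next
      case 5 with cube_count_9_9_9[OF Q, folded defs] \<open>u1 = 0\<close> \<open>u2 = 0\<close> \<open>u3 = 0\<close>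
      show ?thesis by simp
    next
      case 6 with cube_count_9_9_10[OF Q, folded defs] \<open>u1 = 0\<close> \<open>u2 = 0\<close> \<open>u3 = 0\<close>
      show ?thesis by simp
    next
      case 7 with cube_count_9_9_10[OF swap_indep(2)[OF Q], unfolded swap23_counts, folded defs]
        \<open>u1 = 0\<close> \<open>u2 = 0\<close> \<open>u3 = 0\<close>
      show ?thesis by simp
    next
      case 8
      with cube_count_9_9_10[OF swap_indep(2)[OF swap_indep(1)[OF Q]],
          unfolded swap12_counts swap23_counts, folded defs]
        \<open>u1 = 0\<close> \<open>u2 = 0\<close> \<open>u3 = 0\<close>
      show ?thesis by simp
    qed
    then show False using neg 1 \<open>s \<le> 1\<close> by linarith
  next
    case 2
    then show False using neg d fb(4,5,7,8,10,11) s0 by simp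
  next
    case 3
    then show False using neg d fb(4,5,7,8,10,11) s0 by simp
  next
    case 4
    then show False using neg d fb(4,5,7,8,10,11) s0 by simp
  next
    case 5
    then have "s = 0" using s0 by simp
    then have "t1 = 8" "t2 = 8" "t3 = 8"
      using 5 neg d fb(4,7,10) by linarith+
    then have "n \<le> 28" using cube_count_8_8_8[OF Q, folded defs] 5 by blast
    then show False using neg 5 \<open>s = 0\<close> \<open>t1 = 8\<close> \<open>t2 = 8\<close> \<open>t3 = 8\<close> by linarith
  next
    case 6
    then show False using neg d fb(4,5,7,8,10,11) s0 by simp
  next
    case 7
    then show False using neg d fb(4,5,7,8,10,11) s0 by simp
  next
    case 8
    then show False using neg d fb(4,5,7,8,10,11) s0 by simp
  next
    case 9
    then show False using neg d fb(4,5,7,8,10,11) s0 by simp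
  next
    case 10
    then have "t1 \<le> 5" using fb(6) by blast
    then show False using 10 neg d s0 by simp
  qed
qed

lemma hub_slice_bound:
  assumes Q: "indep_cube Q"
  shows "6 * cube_count Q + 9 * (face1 Q + face2 Q + face3 Q) + 8 * (axis1 Q + axis2 Q + axis3 Q)
    + 6 * of_bool (Q None None None) \<le> 413"
proof -
  have *: "6 * cube_count Q + 9 * (face1 Q + face2 Q + face3 Q) + 8 * (axis1 Q + axis2 Q + axis3 Q)
      + 6 * of_bool (Q None None None) \<le> 413"
    if "axis1 Q \<ge> axis2 Q" "axis1 Q \<ge> axis3 Q" "indep_cube Q" for Q
    using hub_slice_bound_sorted[of Q] hub_slice_bound_sorted[of "swap23 Q"] that
    by (cases "axis2 Q \<ge> axis3 Q") (simp_all add: ac_simps)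
  consider "axis1 Q \<ge> axis2 Q" "axis1 Q \<ge> axis3 Q" | "axis2 Q \<ge> axis1 Q" "axis2 Q \<ge> axis3 Q"
    | "axis3 Q \<ge> axis1 Q" "axis3 Q \<ge> axis2 Q" by linarith
  then show ?thesis
    using *[of Q] *[of "swap12 Q"] *[of "swap12 (swap23 Q)"] Q
    by cases (simp_all add: ac_simps)
qed

section \<open>The fourth power\<close>

abbreviation is_hub :: "five option \<Rightarrow> nat" where "is_hub x \<equiv> of_bool (x = None)"

lemma sum_five_option:
  fixes f :: "five option \<Rightarrow> nat"
  shows "sum f UNIV = f None + (\<Sum>a\<in>UNIV. f (Some a))"
  by (simp add: UNIV_option_conv sum.reindex)

lemma weighted_cube_sum:
  fixes g :: "nat \<Rightarrow> nat"
  shows "(\<Sum>x\<in>UNIV. \<Sum>y\<in>UNIV. \<Sum>z\<in>UNIV. g (is_hub x + is_hub y + is_hub z) * of_bool (Q x y z)) =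
    g 0 * cube_count Q + g 1 * (face1 Q + face2 Q + face3 Q) + g 2 * (axis1 Q + axis2 Q + axis3 Q)
      + g 3 * of_bool (Q None None None)"
  unfolding sum_five_option count_defs cube_count_def plane_count_def line_count_def
  by (simp add: sum.distrib sum_distrib_left distrib_left numeral_2_eq_2 numeral_3_eq_3 ac_simps)

text \<open>\<open>n\<close> is the number of hubs among the other three coordinates. The slice
  multiplicities 2 and 6 are included; for a point with two hubs, for instance, the four weights add
  up to 2 * 6 + 2 * 18 = 48.\<close>

definition slice_weight :: "five option \<Rightarrow> nat \<Rightarrow> nat" where
  "slice_weight x n = (if x = None then 2 * ([6, 9, 8, 6] ! n) else 6 * ([2, 2, 1, 0] ! n))"

text \<open>One hub slice and five cycle slices give 2 * 413 + 5 * 6 * 110 = 4126.\<close>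

lemma slice_sum_le:
  assumes "\<And>x. indep_cube (Q x)"
  shows "(\<Sum>x\<in>UNIV. \<Sum>y\<in>UNIV. \<Sum>z\<in>UNIV. \<Sum>w\<in>UNIV.
    slice_weight x (is_hub y + is_hub z + is_hub w) * of_bool (Q x y z w)) \<le> 4126"
proof -
  have hub: "(\<Sum>y\<in>UNIV. \<Sum>z\<in>UNIV. \<Sum>w\<in>UNIV.
      slice_weight None (is_hub y + is_hub z + is_hub w) * of_bool (Q None y z w)) \<le> 826"
    unfolding weighted_cube_sum
    using hub_slice_bound[OF assms[of None]] by (simp add: slice_weight_def numeral_2_eq_2 numeral_3_eq_3)
  have cyc: "(\<Sum>y\<in>UNIV. \<Sum>z\<in>UNIV. \<Sum>w\<in>UNIV.
      slice_weight (Some a) (is_hub y + is_hub z + is_hub w) * of_bool (Q (Some a) y z w)) \<le> 660" for a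
    unfolding weighted_cube_sum
    using cycle_slice_bound[OF assms[of "Some a"]] by (simp add: slice_weight_def numeral_2_eq_2 numeral_3_eq_3)
  show ?thesis
    unfolding sum_five_option[of "\<lambda>x. \<Sum>y\<in>UNIV. \<Sum>z\<in>UNIV. \<Sum>w\<in>UNIV.
      slice_weight x (is_hub y + is_hub z + is_hub w) * of_bool (Q x y z w)"] sum_five
    using hub cyc[of F0] cyc[of F1] cyc[of F2] cyc[of F3] cyc[of F4] by linarith
qed

lemma tesseract_bound:
  fixes Q :: "five option \<Rightarrow> cube"
  assumes "\<And>b c d. indep_line (\<lambda>a. Q a b c d)" "\<And>a c d. indep_line (\<lambda>b. Q a b c d)"
    "\<And>a b d. indep_line (\<lambda>c. Q a b c d)" "\<And>a b c. indep_line (\<lambda>d. Q a b c d)"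
  shows "(\<Sum>a\<in>UNIV. \<Sum>b\<in>UNIV. \<Sum>c\<in>UNIV. \<Sum>d\<in>UNIV. of_bool (Q a b c d)) \<le> (343 :: nat)"
proof -
  let ?h = is_hub
  let ?S = "\<lambda>F :: five option \<Rightarrow> five option \<Rightarrow> five option \<Rightarrow> five option \<Rightarrow> nat.
    \<Sum>a\<in>UNIV. \<Sum>b\<in>UNIV. \<Sum>c\<in>UNIV. \<Sum>d\<in>UNIV. F a b c d"
  \<comment> \<open>These reorderings of the fourfold sum make any chosen coordinate the outermost
    one, as \<open>slice_sum_le\<close> expects.\<close>
  have sw: "?S F = ?S (\<lambda>b a. F a b)" "?S F = ?S (\<lambda>a c b. F a b c)" "?S F = ?S (\<lambda>a b d c. F a b c d)" for F
    by (rule sum.swap sum.cong[OF refl] | assumption)+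
  have s2: "?S F = ?S (\<lambda>b a c d. F a b c d)" for F
    by (rule sum.swap)
  have s3: "?S F = ?S (\<lambda>c a b d. F a b c d)" for F
    by (subst sw(2)) (rule s2)
  have s4: "?S F = ?S (\<lambda>d a b c. F a b c d)" for F
    by (subst sw(3)) (rule s3)
  let ?w1 = "\<lambda>a b c d. slice_weight a (?h b + ?h c + ?h d) * of_bool (Q a b c d)"
  let ?w2 = "\<lambda>a b c d. slice_weight b (?h a + ?h c + ?h d) * of_bool (Q a b c d)"
  let ?w3 = "\<lambda>a b c d. slice_weight c (?h a + ?h b + ?h d) * of_bool (Q a b c d)"
  let ?w4 = "\<lambda>a b c d. slice_weight d (?h a + ?h b + ?h c) * of_bool (Q a b c d)"
  have 1: "?S ?w1 \<le> 4126"
    by (rule slice_sum_le) (simp add: indep_cube_def assms)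
  have 2: "?S ?w2 \<le> 4126"
    by (subst s2, rule slice_sum_le) (simp add: indep_cube_def assms)
  have 3: "?S ?w3 \<le> 4126"
    by (subst s3, rule slice_sum_le) (simp add: indep_cube_def assms)
  have 4: "?S ?w4 \<le> 4126"
    by (subst s4, rule slice_sum_le) (simp add: indep_cube_def assms)
  have w: "slice_weight a (?h b + ?h c + ?h d) + slice_weight b (?h a + ?h c + ?h d) +
      slice_weight c (?h a + ?h b + ?h d) + slice_weight d (?h a + ?h b + ?h c) = 48" for a b c d
    by (cases a; cases b; cases c; cases d; simp add: slice_weight_def numeral_2_eq_2 numeral_3_eq_3)
  have "48 * ?S (\<lambda>a b c d. of_bool (Q a b c d)) = ?S (\<lambda>a b c d. ?w1 a b c d + ?w2 a b c d + ?w3 a b c d + ?w4 a b c d)"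
    by (simp only: sum_distrib_left w flip: distrib_right)
  also have "\<dots> = ?S ?w1 + ?S ?w2 + ?S ?w3 + ?S ?w4"
    by (simp only: sum.distrib)
  also have "\<dots> \<le> 16504"
    using 1 2 3 4 by linarith
  finally show ?thesis by linarith
qed

section \<open>Transfer to the graph product\<close>

fun wheel_vertex :: "five option \<Rightarrow> nat + nat" where
  "wheel_vertex None = Inr 0" |
  "wheel_vertex (Some F0) = Inl 0" |
  "wheel_vertex (Some F1) = Inl 1" |
  "wheel_vertex (Some F2) = Inl 2" |
  "wheel_vertex (Some F3) = Inl 3" |
  "wheel_vertex (Some F4) = Inl 4"

lemma inj_wheel_vertex: "inj wheel_vertex"
proof (rule injI)
  fix x y :: "five option"
  assume "wheel_vertex x = wheel_vertex y"
  then show "x = y"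
    by (cases x rule: wheel_vertex.cases; cases y rule: wheel_vertex.cases) simp_all
qed

lemma pverts_wheel_5: "pverts (wheel 5) = range wheel_vertex"
proof -
  have "{..<5} = {0, 1, 2, 3, 4 :: nat}" by auto
  then show ?thesis
    by (simp add: wheel_def graph_join_def cycle_graph_def complete_graph_def UNIV_option_conv
        UNIV_five Plus_def image_image lessThan_Suc insert_commute)
qed

lemma wheel_vertex_in [simp]: "wheel_vertex x \<in> pverts (wheel 5)"
  by (simp add: pverts_wheel_5)

lemma wheel_5_arcs:
  "(wheel_vertex (Some a), wheel_vertex (Some (nx a))) \<in> parcs (wheel 5)"
  "(wheel_vertex (Some a), wheel_vertex None) \<in> parcs (wheel 5)"
  by (cases a; simp add: wheel_def graph_join_def cycle_graph_def complete_graph_def)+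

lemma pverts_cart_prod [simp]: "pverts (G \<box> H) = pverts G \<times> pverts H"
  by (simp add: cart_prod_def)

lemma parcs_cart_prod:
  assumes "x \<in> pverts H" "(u, v) \<in> parcs G" "u \<in> pverts G" "v \<in> pverts G"
  shows "((u, x), (v, x)) \<in> parcs (G \<box> H)"
  using assms by (simp add: cart_prod_def)

lemma parcs_cart_prod':
  assumes "(x, y) \<in> parcs H" "u \<in> pverts G" "x \<in> pverts H" "y \<in> pverts H"
  shows "((u, x), (u, y)) \<in> parcs (G \<box> H)"
  using assms by (simp add: cart_prod_def)

text \<open>Here \<open>f\<close> traces a line of the product: arcs of the wheel become arcs
  between points of the line, and an independent set contains no two such points.\<close>

lemma indep_line_if_arcs:
  assumes "independent_set G S"
    "\<And>x y. (wheel_vertex x, wheel_vertex y) \<in> parcs (wheel 5) \<Longrightarrow> (f x, f y) \<in> parcs G"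
  shows "indep_line (\<lambda>x. f x \<in> S)"
  using assms wheel_5_arcs unfolding indep_line_def independent_set_def by blast

theorem theorem6p6:
  shows "independence_number (wheel 5 \<box> wheel 5 \<box> wheel 5 \<box> wheel 5) \<le> 343"
proof -
  let ?W = "wheel 5" and ?v = wheel_vertex
  let ?G = "?W \<box> ?W \<box> ?W \<box> ?W"
  have "pair_graph ?G"
    by (intro pair_graph_cart_prod pair_graph_wheel) simp_all
  moreover have "card S \<le> 343" if S: "independent_set ?G S" for S
  proof -
    \<comment> \<open>Quadruples parametrise the vertices, nested to the left like the
      product.\<close>
    define f where "f = (\<lambda>(a, b, c, d). (((?v a, ?v b), ?v c), ?v d))"
    have "inj f"
      by (auto simp: f_def inj_def dest: injD[OF inj_wheel_vertex])
    moreover have "S \<subseteq> range f"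
    proof
      fix s assume "s \<in> S"
      then have "s \<in> pverts ?G" using S by (auto simp: independent_set_def)
      then obtain a b c d where "s = (((?v a, ?v b), ?v c), ?v d)"
        by (auto simp: pverts_wheel_5)
      then show "s \<in> range f" by (intro image_eqI[of _ f "(a, b, c, d)"]) (simp_all add: f_def)
    qed
    ultimately have "card S = card (f -` S)"
      by (simp add: card_vimage_inj)
    also have "\<dots> = (\<Sum>p\<in>UNIV. of_bool (f p \<in> S))"
    proof -
      have "finite (UNIV :: (five option \<times> five option \<times> five option \<times> five option) set)"
        by (simp add: finite_Prod_UNIV)
      then show ?thesis by (simp add: vimage_def)
    qed
    also have "\<dots> = (\<Sum>a\<in>UNIV. \<Sum>b\<in>UNIV. \<Sum>c\<in>UNIV. \<Sum>d\<in>UNIV. of_bool (f (a, b, c, d) \<in> S))"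
      by (simp only: sum.cartesian_product UNIV_Times_UNIV) (rule sum.cong[OF refl], simp add: split_beta)
    also have "\<dots> \<le> 343"
      \<comment> \<open>With three coordinates fixed, a wheel arc in the remaining one is an arc of
        the product.\<close>
      by (rule tesseract_bound; rule indep_line_if_arcs[OF S];
          simp add: f_def parcs_cart_prod parcs_cart_prod')
    finally show ?thesis .
  qed
  ultimately show ?thesis
    by (simp add: independence_number_le_iff)
qed

end
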